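(* Let $q$ be a prime power. Let $Q_1$ and $Q_2$ be two pure subsystem codes with parameters $[[n,k_1,r_1,d_1]]_q$ and $[[n,k_2,r_2,d_2]]_q$, respectively. If $Q_2\subseteq Q_1$ (as subspaces of $\mathbf{C}^{q^n}$), then there exist pure subsystem codes with parameters $$[[2n,\;k_1+k_2+r_1+r_2-r,\;r,\;d]]_q$$ for all $r$ in the range $0\le r\le k_1+k_2+r_1+r_2$, where the minimum distance satisfies $d\ge\min\{d_1,2d_2\}$.
   Context: Let $p$ be the characteristic of $\mathbf{F}_q$. For $(x|y)\in\mathbf{F}_q^{2n}$ (with $x,y\in\mathbf{F}_q^n$), $\mathrm{swt}(x|y)$ is the number of $i$ with $(x_i,y_i)\ne(0,0)$, and $\mathrm{swt}(S)$ is the minimum of $\mathrm{swt}$ over the nonzero elements of $S$. The trace-symplectic product of $(a|b)$ and $(a'|b')$ is $\mathrm{tr}_{q/p}(a'\cdot b-a\cdot b')$, and $C^{\perp_s}$ is the dual of $C\subseteq\mathbf{F}_q^{2n}$ with respect to it. With $\omega=\exp(2\pi i/p)$ and computational basis $|x\rangle$, $x\in\mathbf{F}_q$, of $\mathbf{C}^q$, put $X(a)|x\rangle=|x+a\rangle$, $Z(b)|x\rangle=\omega^{\mathrm{tr}_{q/p}(bx)}|x\rangle$, and for $\mathbf a,\mathbf b\in\mathbf{F}_q^n$ let $X(\mathbf a)=\bigotimes_i X(a_i)$, $Z(\mathbf b)=\bigotimes_i Z(b_i)$ on $\mathbf{C}^{q^n}$. All subsystem codes are Clifford subsystem codes: an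 $((n,K,R,d))_q$ subsystem code is a subspace $Q=A\otimes B$ of $\mathbf{C}^{q^n}$ with $\dim A=K$, $\dim B=R$, derived from an additive subgroup $C\le\mathbf{F}_q^{2n}$ (the zero code is allowed) with $D=C\cap C^{\perp_s}$ such that $|C|=q^nR/K$, $|D|=q^n/(KR)$, and $d=\mathrm{swt}(D^{\perp_s}\setminus C)$ if $D^{\perp_s}\ne C$, while $d=\mathrm{swt}(D^{\perp_s})$ if $D^{\perp_s}=C$ (the case $K=1$); as a subspace, $Q$ is a ($KR$-dimensional) nonzero joint eigenspace of the commuting operators $X(\mathbf a)Z(\mathbf b)$ with $(\mathbf a|\mathbf b)\in D$. Existence of an $((n,K,R,d))_q$ subsystem code is equivalent to existence of such a $C$. $[[n,k,r,d]]_q$ means $((n,q^k,q^r,d))_q$. The code derived from $C$ is pure to $d'$ if $C$ contains no nonzero element of symplectic weight less than $d'$; it is pure if it is pure to its minimum distance $d$. *)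

theory Defs
  imports
    "HOL-Analysis.Analysis"
    "HOL-Computational_Algebra.Computational_Algebra"
begin

text \<open>
  The field \<open>F\<^sub>q\<close> is a type \<open>'a\<close> of class \<^class>\<open>finite_field\<close>, with \<open>q = CARD('a)\<close> and
  \<open>p = CHAR('a)\<close>. Coordinates are indexed by a finite type \<open>'n\<close>, so the length is \<open>n = CARD('n)\<close>.
  An element \<open>(x|y)\<close> of \<open>F\<^sub>q\<^sup>2\<^sup>n\<close> is a pair of vectors, and the state space of
  \<open>n\<close> qudits is \<open>complex^('a^'n)\<close>, whose coordinates are indexed by the computational basis.
\<close>

section \<open>Trace and additive character\<close>

definition prime_degree :: "'a::finite_field itself \<Rightarrow> nat" where
  "prime_degree _ = (THE m. CARD('a) = CHAR('a) ^ m)"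

definition abs_trace :: "'a::finite_field \<Rightarrow> 'a" where
  "abs_trace x = (\<Sum>i<prime_degree TYPE('a). x ^ (CHAR('a) ^ i))"

text \<open>
  The trace takes values in the prime field, here the copy of it inside \<open>'a\<close>; to use it as
  an exponent of \<open>\<omega>\<close> it is replaced by its representative in \<open>{0..<p}\<close>.
\<close>

definition abs_trace_rep :: "'a::finite_field \<Rightarrow> nat" where
  "abs_trace_rep x = (THE k. k < CHAR('a) \<and> of_nat k = abs_trace x)"

definition add_char :: "'a::finite_field \<Rightarrow> complex" where
  "add_char x = exp (2 * pi * \<i> / of_nat CHAR('a)) ^ abs_trace_rep x"


section \<open>Additive codes\<close>

definition add_subgroup :: "'g::ab_group_add set \<Rightarrow> bool" where
  "add_subgroup C \<longleftrightarrow> 0 \<in> C \<and> (\<forall>u\<in>C. \<forall>v\<in>C. u - v \<in> C)"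

definition swt :: "('a::finite_field^'n) \<times> ('a^'n) \<Rightarrow> nat" where
  "swt v = card {i. (fst v $ i, snd v $ i) \<noteq> (0, 0)}"

definition min_swt :: "(('a::finite_field^'n) \<times> ('a^'n)) set \<Rightarrow> nat" where
  "min_swt S = Min (swt ` (S - {0}))"

definition tr_symp :: "('a::finite_field^'n) \<times> ('a^'n) \<Rightarrow> ('a^'n) \<times> ('a^'n) \<Rightarrow> 'a" where
  "tr_symp = (\<lambda>(a, b) (a', b'). abs_trace (scalar_product a' b - scalar_product a b'))"

definition symp_dual :: "(('a::finite_field^'n) \<times> ('a^'n)) set \<Rightarrow> (('a^'n) \<times> ('a^'n)) set" where
  "symp_dual C = {v. \<forall>c\<in>C. tr_symp v c = 0}"


section \<open>Error operators and their joint eigenspaces\<close>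

text \<open>Entry \<open>M $ y $ x\<close> is the coefficient of \<open>|y\<rangle>\<close> in the image of \<open>|x\<rangle>\<close>.\<close>

definition X_op :: "'a::finite_field \<Rightarrow> complex^('a::finite_field)^('a::finite_field)" where
  "X_op a = (\<chi> y x. if y = x + a then 1 else 0)"

definition Z_op :: "'a::finite_field \<Rightarrow> complex^('a::finite_field)^('a::finite_field)" where
  "Z_op b = (\<chi> y x. if y = x then add_char (b * x) else 0)"

definition tensor_op :: "('n::finite \<Rightarrow> complex^('a::finite_field)^('a::finite_field)) \<Rightarrow> complex^('a^'n)^('a^'n)" where
  "tensor_op M = (\<chi> y x. \<Prod>i\<in>UNIV. M i $ (y $ i) $ (x $ i))"

definition error_op ::
    "('a::finite_field^'n) \<times> ('a^'n) \<Rightarrow> complex^('a^'n)^('a^'n)" where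
  "error_op v = tensor_op (\<lambda>i. X_op (fst v $ i)) ** tensor_op (\<lambda>i. Z_op (snd v $ i))"

definition joint_eigenspace ::
    "(('a::finite_field^'n) \<times> ('a^'n)) set \<Rightarrow> (complex^('a^'n)) set \<Rightarrow> bool" where
  "joint_eigenspace D Q \<longleftrightarrow>
     Q \<noteq> {0} \<and> (\<exists>\<mu>. Q = {\<psi>. \<forall>v\<in>D. error_op v *v \<psi> = \<mu> v *s \<psi>})"


section \<open>Clifford subsystem codes\<close>

text \<open>
  \<open>subsystem_code Q C K R d\<close> means that \<open>Q\<close> is an \<open>((n,K,R,d))\<^sub>q\<close> Clifford subsystem code
  derived from \<open>C\<close>. As a factorization of the subspace \<open>Q\<close> into an abstract tensor product
  \<open>A \<otimes> B\<close> with \<open>dim A = K\<close> and \<open>dim B = R\<close> exists iff \<open>dim Q = K R\<close>, the latter is what is recorded.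
\<close>

definition subsystem_code ::
    "(complex^('a::finite_field^'n)) set \<Rightarrow> (('a^'n) \<times> ('a^'n)) set \<Rightarrow> nat \<Rightarrow> nat \<Rightarrow> nat \<Rightarrow> bool" where
  "subsystem_code Q C K R d \<longleftrightarrow>
     (let D = C \<inter> symp_dual C in
        add_subgroup C \<and> 1 \<le> K \<and> 1 \<le> R \<and>
        real (card C) = real CARD('a) ^ CARD('n) * real R / real K \<and>
        real (card D) = real CARD('a) ^ CARD('n) / (real K * real R) \<and>
        d = (if symp_dual D \<noteq> C then min_swt (symp_dual D - C) else min_swt (symp_dual D)) \<and>
        joint_eigenspace D Q \<and> vec.dim Q = K * R)"

text \<open>
  The parameters \<open>[[n,k,r,d]]\<^sub>q\<close> stand for \<open>((n,q\<^sup>k,q\<^sup>r,d))\<^sub>q\<close>. For additive codes over a non-prime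
  field the exponents may be fractional, so they are real numbers whose powers \<open>q\<^sup>k\<close> and \<open>q\<^sup>r\<close>
  are natural numbers.
\<close>

definition subsystem_code_log ::
    "(complex^('a::finite_field^'n)) set \<Rightarrow> (('a^'n) \<times> ('a^'n)) set \<Rightarrow> real \<Rightarrow> real \<Rightarrow> nat \<Rightarrow> bool" where
  "subsystem_code_log Q C k r d \<longleftrightarrow>
     (\<exists>K R. real K = real CARD('a) powr k \<and> real R = real CARD('a) powr r \<and>
            subsystem_code Q C K R d)"

definition pure_to :: "(('a::finite_field^'n) \<times> ('a^'n)) set \<Rightarrow> nat \<Rightarrow> bool" where
  "pure_to C d \<longleftrightarrow> (\<forall>c\<in>C. c \<noteq> 0 \<longrightarrow> \<not> swt c < d)"

definition pure_subsystem_code ::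
    "(complex^('a::finite_field^'n)) set \<Rightarrow> (('a^'n) \<times> ('a^'n)) set \<Rightarrow> real \<Rightarrow> real \<Rightarrow> nat \<Rightarrow> bool" where
  "pure_subsystem_code Q C k r d \<longleftrightarrow> subsystem_code_log Q C k r d \<and> pure_to C d"

end

theory Submission
  imports Defs "HOL-Number_Theory.Cong"
begin

text \<open>
  Write \<open>D\<^sub>i = C\<^sub>i \<inter> C\<^sub>i\<^sup>\<bottom>\<close> and \<open>E\<^sub>i = D\<^sub>i\<^sup>\<bottom>\<close>. An element of \<open>D\<^sub>1\<close> acts as a scalar on \<open>Q\<^sub>2\<close>, while
  \<open>D\<^sub>2\<^sup>\<bottom>\<close> acts on \<open>Q\<^sub>2\<close> and an element commuting with all of it lies in \<open>D\<^sub>2\<close>; hence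
  \<open>D\<^sub>1 \<subseteq> D\<^sub>2\<close>, so \<open>d\<^sub>1 \<le> d\<^sub>2\<close> and it suffices to reach the distance \<open>\<delta> = d\<^sub>1\<close>. By purity \<open>\<delta>\<close> is the minimum
  weight of \<open>E\<^sub>1\<close>, hence of \<open>E = E\<^sub>1 \<oplus> E\<^sub>2 = D\<^sup>\<bottom>\<close> for the isotropic group \<open>D = D\<^sub>1 \<oplus> D\<^sub>2\<close>.

  A subsystem code with given \<open>D\<close> and dimensions arises from a subgroup \<open>C\<close> with \<open>D \<subseteq> C \<subseteq> E\<close> and
  \<open>C \<inter> C\<^sup>\<bottom> = D\<close>. It is pure if a word \<open>e\<close> of minimum weight stays outside of \<open>C\<close>, which is
  possible as soon as \<open>e \<notin> D\<close>: take for \<open>C\<close> the orthogonal of a sum of hyperbolic planes containing \<open>e\<close>.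
  If all words of weight \<open>\<delta>\<close> lie in \<open>D\<close>, then \<open>D\<close> has to be replaced by another isotropic group of the
  same order. Here the doubled length helps: words \<open>t\<^sub>1\<close>, \<open>t\<^sub>2\<close> of weights \<open>\<lceil>\<delta>/2\<rceil>\<close>, \<open>\<lfloor>\<delta>/2\<rfloor>\<close>, each
  of minimum weight in its coset, give \<open>t = (t\<^sub>1, t\<^sub>2)\<close> such that \<open>E + \<langle>t\<rangle>\<close> still has minimum weight
  \<open>\<delta>\<close>, and if \<open>t\<close> is not orthogonal to \<open>e\<close>, then \<open>e\<close> is outside of \<open>(E + \<langle>t\<rangle>)\<^sup>\<bottom>\<close>, which can
  be enlarged to the order of \<open>D\<close> without swallowing \<open>e\<close>.
\<close>


section \<open>The prime field and the trace\<close>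

text \<open>Described as the fixed points of Frobenius, it is closed under sums by the freshman's
  dream and under products and quotients by the power laws.\<close>

definition prime_field :: "'a::finite_field set" where
  "prime_field = {x. x ^ CHAR('a) = x}"

lemma CHAR_gt_1: "CHAR('a::finite_field) > 1"
  using prime_gt_1_nat[OF CHAR_prime[where 'a='a]] .

lemma of_nat_inj_on_CHAR: "inj_on (of_nat :: nat \<Rightarrow> 'a::finite_field) {..<CHAR('a)}"
  by (rule inj_onI) (auto simp: of_nat_eq_iff_cong_CHAR cong_def)

lemma of_nat_prime_field: "(of_nat k :: 'a::finite_field) \<in> prime_field"
proof -
  have "(of_nat k :: 'a) ^ CHAR('a) = of_nat k"
  proof (induction k)
    case 0
    then show ?case using CHAR_pos[where 'a='a] by (simp add: power_0_left)
  next
    case (Suc k)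
    have "(of_nat (Suc k) :: 'a) ^ CHAR('a) = (1 + of_nat k) ^ CHAR('a)" by simp
    also have "\<dots> = 1 ^ CHAR('a) + of_nat k ^ CHAR('a)"
      by (rule freshmans_dream) auto
    finally show ?case using Suc by simp
  qed
  then show ?thesis by (simp add: prime_field_def)
qed

text \<open>The polynomial \<open>X^p - X\<close> has at most \<open>p\<close> roots, and the
  \<open>p\<close> distinct multiples of 1 are among them.\<close>

lemma prime_field_eq: "(prime_field :: 'a::finite_field set) = of_nat ` {..<CHAR('a)}"
proof -
  define f :: "'a poly" where "f = monom 1 CHAR('a) - monom 1 1"
  have p: "CHAR('a) > 1" by (rule CHAR_gt_1)
  have "coeff f CHAR('a) = 1" using p by (simp add: f_def)
  then have f0: "f \<noteq> 0" by auto
  have roots: "{x. poly f x = 0} = prime_field"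
    by (auto simp: f_def prime_field_def poly_monom)
  have "card (prime_field :: 'a set) \<le> degree f"
    using card_poly_roots_bound[OF f0] roots by simp
  also have "\<dots> \<le> CHAR('a)"
    unfolding f_def by (rule degree_diff_le) (use p in \<open>auto intro: order_trans[OF degree_monom_le]\<close>)
  also have "\<dots> = card ((of_nat :: nat \<Rightarrow> 'a) ` {..<CHAR('a)})"
    by (simp add: card_image of_nat_inj_on_CHAR)
  finally show ?thesis
    by (intro card_seteq[symmetric]) (auto simp: of_nat_prime_field)
qed

lemma card_prime_field: "card (prime_field :: 'a::finite_field set) = CHAR('a)"
  by (simp add: prime_field_eq card_image of_nat_inj_on_CHAR)

lemma prime_field_0: "0 \<in> prime_field"
  using of_nat_prime_field[of 0] by simp

lemma prime_field_1: "1 \<in> prime_field"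
  by (simp add: prime_field_def)

lemma prime_field_add: "x \<in> prime_field \<Longrightarrow> y \<in> prime_field \<Longrightarrow> x + y \<in> prime_field"
  by (simp add: prime_field_def freshmans_dream)

lemma prime_field_mult: "x \<in> prime_field \<Longrightarrow> y \<in> prime_field \<Longrightarrow> x * y \<in> prime_field"
  by (simp add: prime_field_def power_mult_distrib)

lemma prime_field_divide: "x \<in> prime_field \<Longrightarrow> y \<in> prime_field \<Longrightarrow> x / y \<in> prime_field"
  by (simp add: prime_field_def power_divide)

lemma prime_field_uminus: "x \<in> prime_field \<Longrightarrow> - x \<in> (prime_field :: 'a::finite_field set)"
proof -
  assume x: "x \<in> prime_field"
  have "(-1 :: 'a) = of_nat (CHAR('a) - 1)"
    using of_nat_diff[of 1 "CHAR('a)", where 'a='a] CHAR_pos[where 'a='a] by (simp del: CHAR_pos)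
  then have "(-1 :: 'a) \<in> prime_field" using of_nat_prime_field by metis
  from prime_field_mult[OF this x] show ?thesis by simp
qed

lemma prime_field_diff: "x \<in> prime_field \<Longrightarrow> y \<in> prime_field \<Longrightarrow> x - y \<in> prime_field"
  using prime_field_add[of x "- y"] prime_field_uminus[of y] by simp

lemma add_subgroup_add:
  assumes "add_subgroup S" "x \<in> S" "y \<in> S" shows "x + y \<in> S"
proof -
  have "0 - y \<in> S" using assms unfolding add_subgroup_def by blast
  then have "x - (0 - y) \<in> S" using assms unfolding add_subgroup_def by blast
  then show ?thesis by simp
qed

lemma add_subgroup_0: "add_subgroup S \<Longrightarrow> 0 \<in> S"
  by (simp add: add_subgroup_def)

lemma add_subgroup_diff: "add_subgroup S \<Longrightarrow> x \<in> S \<Longrightarrow> y \<in> S \<Longrightarrow> x - y \<in> S"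
  by (simp add: add_subgroup_def)

lemma add_subgroup_Int: "add_subgroup S \<Longrightarrow> add_subgroup T \<Longrightarrow> add_subgroup (S \<inter> T)"
  by (simp add: add_subgroup_def)


section \<open>Additive subgroups of a finite vector space\<close>

locale finite_space = vector_space scale
  for scale :: "'a::finite_field \<Rightarrow> 'v::{ab_group_add,finite} \<Rightarrow> 'v" (infixr \<open>*v*\<close> 75)
begin

text \<open>For a subgroup \<open>S\<close> this is the subgroup generated by \<open>S\<close> and
  \<open>v\<close>. Coefficients come from the prime field because additive subgroups need not be
  stable under the larger field.\<close>

definition adjoin :: "'v set \<Rightarrow> 'v \<Rightarrow> 'v set" where
  "adjoin S v = (\<lambda>(s, c). s + c *v* v) ` (S \<times> prime_field)"

lemma adjoinE:
  assumes "x \<in> adjoin S v"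
  obtains s c where "s \<in> S" "c \<in> prime_field" "x = s + c *v* v"
  using assms by (auto simp: adjoin_def)

lemma adjoinI: "s \<in> S \<Longrightarrow> c \<in> prime_field \<Longrightarrow> s + c *v* v \<in> adjoin S v"
  by (auto simp: adjoin_def)

lemma subgroup_scale:
  assumes S: "add_subgroup S" and "x \<in> S" "c \<in> prime_field"
  shows "c *v* x \<in> S"
proof -
  have "of_nat k *v* x \<in> S" for k
    by (induction k) (use assms in \<open>auto simp: scale_left_distrib add_subgroup_0 intro: add_subgroup_add\<close>)
  then show ?thesis using assms by (auto simp: prime_field_eq)
qed

lemma subset_adjoin: "S \<subseteq> adjoin S v"
  using adjoinI[of _ S 0 v] by (auto simp: prime_field_0)

lemma mem_adjoin: "add_subgroup S \<Longrightarrow> v \<in> adjoin S v"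
  using adjoinI[of 0 S 1 v] by (auto simp: prime_field_1 add_subgroup_0)

lemma subgroup_adjoin:
  assumes S: "add_subgroup S" shows "add_subgroup (adjoin S v)"
  unfolding add_subgroup_def
proof (intro conjI ballI)
  show "0 \<in> adjoin S v" using subset_adjoin[of S v] add_subgroup_0[OF S] by auto
  fix x y assume "x \<in> adjoin S v" "y \<in> adjoin S v"
  then obtain s c t e where *: "s \<in> S" "c \<in> prime_field" "x = s + c *v* v"
    "t \<in> S" "e \<in> prime_field" "y = t + e *v* v" by (elim adjoinE) blast
  then have "x - y = (s - t) + (c - e) *v* v"
    by (simp add: scale_left_diff_distrib)
  also have "\<dots> \<in> adjoin S v"
    by (rule adjoinI) (use * in \<open>auto intro: add_subgroup_diff[OF S] prime_field_diff\<close>)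
  finally show "x - y \<in> adjoin S v" .
qed

lemma adjoin_least:
  assumes "add_subgroup T" "S \<subseteq> T" "v \<in> T" shows "adjoin S v \<subseteq> T"
proof
  fix x assume "x \<in> adjoin S v"
  then obtain s c where "s \<in> S" "c \<in> prime_field" "x = s + c *v* v" by (rule adjoinE)
  then show "x \<in> T" using assms by (auto intro: add_subgroup_add subgroup_scale)
qed

text \<open>If two representations had different coefficients, a nonzero prime-field multiple of
  \<open>v\<close> would lie in \<open>S\<close>, and dividing would put \<open>v\<close> itself
  there.\<close>

lemma card_adjoin:
  assumes S: "add_subgroup S" and v: "v \<notin> S"
  shows "card (adjoin S v) = CHAR('a) * card S"
proof -
  have "inj_on (\<lambda>(s, c). s + c *v* v) (S \<times> prime_field)"
  proof (rule inj_onI, clarify)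
    fix s c t e assume *: "s \<in> S" "c \<in> prime_field" "t \<in> S" "e \<in> prime_field"
      and eq: "s + c *v* v = t + e *v* v"
    have "c = e"
    proof (rule ccontr)
      assume ne: "c \<noteq> e"
      have "(c - e) *v* v = t - s"
        using eq by (simp add: scale_left_diff_distrib algebra_simps)
      moreover have "t - s \<in> S" using * S by (simp add: add_subgroup_diff)
      moreover have "1 / (c - e) \<in> prime_field"
        using * by (intro prime_field_divide prime_field_diff prime_field_1)
      ultimately have "(1 / (c - e)) *v* (c - e) *v* v \<in> S"
        using subgroup_scale[OF S] by simp
      then show False using ne v by simp
    qed
    with eq show "s = t \<and> c = e" by simp
  qed
  then show ?thesis
    by (simp add: adjoin_def card_image card_cartesian_product card_prime_field mult.commute)
qed

text \<open>\<open>T\<close> is reached from \<open>S\<close> by adjoining one generator at a time;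
  the number of elements of \<open>T\<close> still missing decreases.\<close>

lemma subgroup_induct:
  assumes "add_subgroup S" and T: "add_subgroup T" "S \<subseteq> T" and "P S"
    and step: "\<And>U v. add_subgroup U \<Longrightarrow> S \<subseteq> U \<Longrightarrow> U \<subseteq> T \<Longrightarrow> v \<in> T \<Longrightarrow> v \<notin> U \<Longrightarrow> P U \<Longrightarrow> P (adjoin U v)"
  shows "P T"
proof -
  have "P T" if "add_subgroup U" "S \<subseteq> U" "U \<subseteq> T" "P U" for U
    using that
  proof (induction "card T - card U" arbitrary: U rule: less_induct)
    case less
    show ?case
    proof (cases "U = T")
      case False
      then obtain v where v: "v \<in> T" "v \<notin> U" using less.prems by blast
      have sub: "adjoin U v \<subseteq> T" using adjoin_least[OF T(1)] less.prems v by auto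
      have "U \<subset> adjoin U v"
        using subset_adjoin[of U v] mem_adjoin[OF less.prems(1), of v] v by auto
      then have "card U < card (adjoin U v)" by (intro psubset_card_mono) auto
      moreover have "card (adjoin U v) \<le> card T" using sub by (intro card_mono) auto
      ultimately have "card T - card (adjoin U v) < card T - card U" by auto
      then show ?thesis
        using less.hyps[of "adjoin U v"] less.prems sub subgroup_adjoin subset_adjoin[of U v]
          step[of U v] v by blast
    qed (use less in auto)
  qed
  from this[OF assms(1) order_refl T(2) \<open>P S\<close>] show ?thesis .
qed

lemma subgroup_zero: "add_subgroup {0::'v}"
  by (simp add: add_subgroup_def)

lemma subgroup_UNIV: "add_subgroup (UNIV :: 'v set)"
  by (simp add: add_subgroup_def)

lemma card_subgroup_prime_power:
  assumes T: "add_subgroup (T :: 'v set)"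
  shows "\<exists>k. card T = CHAR('a) ^ k"
proof -
  have "{0} \<subseteq> T" using add_subgroup_0[OF T] by auto
  show ?thesis
  proof (rule subgroup_induct[OF subgroup_zero T \<open>{0} \<subseteq> T\<close>])
    show "\<exists>k. card {0::'v} = CHAR('a) ^ k" by (rule exI[of _ 0]) simp
  next
    fix U :: "'v set" and v assume U: "add_subgroup U" "v \<notin> U" and "\<exists>k. card U = CHAR('a) ^ k"
    then obtain k where "card U = CHAR('a) ^ k" by blast
    with U show "\<exists>k. card (adjoin U v) = CHAR('a) ^ k"
      by (intro exI[of _ "Suc k"]) (simp add: card_adjoin)
  qed
qed

text \<open>Rank-nullity for a functional with values in the prime field: subtracting the right
  multiple of \<open>v\<close> moves any element of \<open>T\<close> into the kernel.\<close>

lemma adjoin_kernel: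
  fixes \<phi> :: "'v \<Rightarrow> 'a"
  assumes T: "add_subgroup T" and v: "v \<in> T" "\<phi> v \<noteq> 0"
    and \<phi>: "\<And>x y. \<phi> (x + y) = \<phi> x + \<phi> y" "\<And>c x. c \<in> prime_field \<Longrightarrow> \<phi> (c *v* x) = c * \<phi> x"
      "\<And>x. \<phi> x \<in> prime_field"
  shows "adjoin {x \<in> T. \<phi> x = 0} v = T" "v \<notin> {x \<in> T. \<phi> x = 0}" "add_subgroup {x \<in> T. \<phi> x = 0}"
proof -
  have diff: "\<phi> (x - y) = \<phi> x - \<phi> y" for x y
    using \<phi>(1)[of "x - y" y] by simp
  have zero: "\<phi> 0 = 0" using diff[of 0 0] by simp
  show "add_subgroup {x \<in> T. \<phi> x = 0}"
    using T by (auto simp: add_subgroup_def diff zero)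
  show "v \<notin> {x \<in> T. \<phi> x = 0}" using v by simp
  show "adjoin {x \<in> T. \<phi> x = 0} v = T"
  proof
    show "adjoin {x \<in> T. \<phi> x = 0} v \<subseteq> T" by (rule adjoin_least[OF T]) (use v in auto)
    show "T \<subseteq> adjoin {x \<in> T. \<phi> x = 0} v"
    proof
      fix x assume x: "x \<in> T"
      define c where "c = \<phi> x / \<phi> v"
      have c: "c \<in> prime_field" by (simp add: c_def \<phi> prime_field_divide)
      have "x - c *v* v \<in> T" by (rule add_subgroup_diff[OF T x subgroup_scale[OF T v(1) c]])
      moreover have "\<phi> (x - c *v* v) = 0" using v by (simp add: diff \<phi>(2) c) (simp add: c_def)
      ultimately show "x \<in> adjoin {x \<in> T. \<phi> x = 0} v"
        using adjoinI[of "x - c *v* v" _ c v] c by auto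
    qed
  qed
qed

end

section \<open>The absolute trace\<close>

interpretation field_space: finite_space "(*) :: 'a::finite_field \<Rightarrow> 'a \<Rightarrow> 'a"
  by unfold_locales

text \<open>The order of the field is a power of \<open>p\<close> as for every subgroup, and the
  exponent is unique, so the definite description in \<open>prime_degree\<close> denotes it.\<close>

lemma CARD_prime_degree: "CARD('a::finite_field) = CHAR('a) ^ prime_degree TYPE('a)"
proof -
  obtain k where k: "CARD('a) = CHAR('a) ^ k"
    using field_space.card_subgroup_prime_power[OF field_space.subgroup_UNIV] by blast
  have "CHAR('a) > 1" by (rule CHAR_gt_1)
  then have "(THE m. CARD('a) = CHAR('a) ^ m) = k"
    by (intro the_equality k) (simp add: k power_inject_exp)
  then show ?thesis using k by (simp only: prime_degree_def)
qed

lemma prime_degree_pos: "prime_degree TYPE('a::finite_field) > 0"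
proof (rule ccontr)
  assume "\<not> ?thesis"
  then have "CARD('a) = 1" using CARD_prime_degree[where 'a='a] by simp
  then obtain x :: 'a where "UNIV = {x}" by (metis card_1_singletonE)
  then show False by (metis UNIV_I singletonD zero_neq_one)
qed

lemma abs_trace_add: "abs_trace (x + y :: 'a::finite_field) = abs_trace x + abs_trace y"
  unfolding abs_trace_def by (simp add: freshmans_dream' sum.distrib)

lemma abs_trace_0: "abs_trace (0 :: 'a::finite_field) = 0"
  using abs_trace_add[of "0::'a" 0] by (metis add_cancel_left_right)

lemma abs_trace_uminus: "abs_trace (- x :: 'a::finite_field) = - abs_trace x"
  using abs_trace_add[of "- x" x] by (simp add: abs_trace_0 eq_neg_iff_add_eq_0)

lemma abs_trace_diff: "abs_trace (x - y :: 'a::finite_field) = abs_trace x - abs_trace y"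
  using abs_trace_add[of x "- y"] by (simp add: abs_trace_uminus)

lemma abs_trace_sum: "abs_trace (sum f A :: 'a::finite_field) = (\<Sum>i\<in>A. abs_trace (f i))"
  by (induction A rule: infinite_finite_induct) (auto simp: abs_trace_0 abs_trace_add)

lemma prime_field_power: "c \<in> prime_field \<Longrightarrow> c ^ (CHAR('a) ^ i) = (c :: 'a::finite_field)"
  by (induction i) (auto simp: prime_field_def power_mult)

lemma abs_trace_mult: "c \<in> prime_field \<Longrightarrow> abs_trace (c * x :: 'a::finite_field) = c * abs_trace x"
  by (simp add: abs_trace_def power_mult_distrib prime_field_power sum_distrib_left)

text \<open>Frobenius permutes the summands of the trace cyclically, because \<open>x^q = x\<close>;
  hence it fixes the trace.\<close>

lemma abs_trace_prime_field: "abs_trace (x :: 'a::finite_field) \<in> prime_field"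
proof -
  define m where "m = prime_degree TYPE('a)"
  define f where "f i = x ^ (CHAR('a) ^ i)" for i
  have fm: "f m = x" using finite_field_power_card_eq_same[of x]
    by (simp add: f_def m_def CARD_prime_degree)
  have "abs_trace x ^ CHAR('a) = (\<Sum>i<m. f i ^ CHAR('a))"
    unfolding abs_trace_def f_def m_def by (rule freshmans_dream_sum) auto
  also have "\<dots> = (\<Sum>i<m. f (Suc i))"
    by (simp add: f_def power_mult[symmetric] mult.commute)
  also have "\<dots> = (\<Sum>i<m. f i)"
    using sum.lessThan_Suc_shift[of f m] sum.lessThan_Suc[of f m] fm by (simp add: f_def)
  also have "\<dots> = abs_trace x" by (simp add: abs_trace_def f_def m_def)
  finally show ?thesis by (simp add: prime_field_def)
qed

text \<open>The trace is a polynomial function of degree at most \<open>p^(m-1) < q\<close>, nonzero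
  because \<open>X\<close> has coefficient 1, so it cannot vanish at all \<open>q\<close>
  elements.\<close>

lemma abs_trace_surj: "\<exists>x. abs_trace (x :: 'a::finite_field) \<noteq> 0"
proof (rule ccontr)
  assume "\<not> ?thesis"
  then have all: "abs_trace x = 0" for x :: 'a by simp
  define m where "m = prime_degree TYPE('a)"
  have p: "CHAR('a) > 1" by (rule CHAR_gt_1)
  define f :: "'a poly" where "f = (\<Sum>i<m. monom 1 (CHAR('a) ^ i))"
  have "poly f x = abs_trace x" for x
    by (simp add: f_def abs_trace_def m_def poly_sum poly_monom)
  then have roots: "{x. poly f x = 0} = UNIV" using all by simp
  have "coeff f 1 = (\<Sum>i<m. if i = 0 then 1 else 0)"
    unfolding f_def coeff_sum by (rule sum.cong) (use p in auto)
  also have "\<dots> = 1" using prime_degree_pos[where 'a='a] by (simp add: m_def)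
  finally have f0: "f \<noteq> 0" by auto
  have "CARD('a) \<le> degree f"
    using card_poly_roots_bound[OF f0] roots by simp
  also have "degree f \<le> CHAR('a) ^ (m - 1)"
    unfolding f_def
    by (rule degree_sum_le) (use p in \<open>auto intro!: order_trans[OF degree_monom_le] power_increasing\<close>)
  also have "\<dots> < CHAR('a) ^ m"
    using p prime_degree_pos[where 'a='a] by (intro power_strict_increasing) (auto simp: m_def)
  also have "\<dots> = CARD('a)" by (simp add: CARD_prime_degree m_def)
  finally show False by simp
qed


section \<open>The trace-symplectic form\<close>

abbreviation scale_pair :: "'a::finite_field \<Rightarrow> ('a^'n) \<times> ('a^'n) \<Rightarrow> ('a^'n) \<times> ('a^'n)" where
  "scale_pair c v \<equiv> (c *s fst v, c *s snd v)"

interpretation pairs: finite_space "scale_pair :: 'a::finite_field \<Rightarrow> ('a^'n) \<times> ('a^'n) \<Rightarrow> _"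
  by unfold_locales (auto simp: vector_add_ldistrib vector_sadd_rdistrib vector_smult_assoc)

text \<open>Weight and symplectic form are sums of contributions of single coordinates, so most
  arguments below look at one pair of entries at a time.\<close>

definition site :: "('a::finite_field^'n) \<times> ('a^'n) \<Rightarrow> 'n \<Rightarrow> 'a \<times> 'a" where
  "site v i = (fst v $ i, snd v $ i)"

definition of_sites :: "('n \<Rightarrow> 'a \<times> 'a) \<Rightarrow> ('a::finite_field^'n) \<times> ('a^'n)" where
  "of_sites f = (\<chi> i. fst (f i), \<chi> i. snd (f i))"

definition site_form :: "'a::finite_field \<times> 'a \<Rightarrow> 'a \<times> 'a \<Rightarrow> 'a" where
  "site_form x y = abs_trace (fst y * snd x - fst x * snd y)"

lemma site_of_sites [simp]: "site (of_sites f) i = f i"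
  by (simp add: site_def of_sites_def)

lemma site_zero [simp]: "site 0 i = 0"
  by (simp add: site_def zero_prod_def)

lemma site_add [simp]: "site (v + w) i = site v i + site w i"
  by (simp add: site_def plus_prod_def)

lemma site_diff [simp]: "site (v - w) i = site v i - site w i"
  by (simp add: site_def minus_prod_def)

lemma site_uminus [simp]: "site (- v) i = - site v i"
  by (simp add: site_def uminus_prod_def)

lemma site_eqI: "(\<And>i. site v i = site w i) \<Longrightarrow> v = w"
  by (auto simp: site_def vec_eq_iff intro!: prod_eqI)

lemma swt_site: "swt v = card {i. site v i \<noteq> 0}"
  by (simp add: swt_def site_def zero_prod_def)

lemma tr_symp_site: "tr_symp v w = (\<Sum>i\<in>UNIV. site_form (site v i) (site w i))"
  by (cases v; cases w)
     (simp add: tr_symp_def scalar_product_def site_form_def site_def abs_trace_sum abs_trace_diff sum_subtractf)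

lemma site_form_add_left: "site_form (x + y) z = site_form x z + site_form y z"
  by (simp add: site_form_def algebra_simps flip: abs_trace_add)

lemma site_form_antisym: "site_form x y = - site_form y x"
  by (simp add: site_form_def algebra_simps flip: abs_trace_uminus)

lemma site_form_0 [simp]: "site_form 0 x = 0" "site_form x 0 = 0"
  by (simp_all add: site_form_def abs_trace_0)

lemma site_form_self [simp]: "site_form x x = 0"
  by (simp add: site_form_def abs_trace_0 mult.commute)

lemma site_form_nondegenerate:
  assumes "x \<noteq> 0" shows "\<exists>y. site_form y x \<noteq> 0"
proof -
  obtain z :: 'a where z: "abs_trace z \<noteq> 0" using abs_trace_surj by blast
  show ?thesis
  proof (cases "fst x = 0")
    case True
    then have "snd x \<noteq> 0" using assms by (simp add: prod_eq_iff)
    then have "site_form (- z / snd x, 0) x \<noteq> 0" using z True by (simp add: site_form_def)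
    then show ?thesis by blast
  next
    case False
    then have "site_form (0, z / fst x) x \<noteq> 0" using z by (simp add: site_form_def)
    then show ?thesis by blast
  qed
qed

lemma tr_symp_add_left: "tr_symp (u + v) w = tr_symp u w + tr_symp v w"
  by (simp add: tr_symp_site site_form_add_left sum.distrib)

lemma tr_symp_antisym: "tr_symp v w = - tr_symp w v"
  unfolding tr_symp_site by (subst site_form_antisym) (simp add: sum_negf)

lemma tr_symp_add_right: "tr_symp w (u + v) = tr_symp w u + tr_symp w v"
  using tr_symp_antisym[of w] tr_symp_add_left[of u v w] by simp

lemma tr_symp_self [simp]: "tr_symp v v = 0"
  by (simp add: tr_symp_site)

lemma tr_symp_prime_field: "tr_symp v w \<in> prime_field"
  by (cases v; cases w) (simp add: tr_symp_def abs_trace_prime_field)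

lemma tr_symp_scale_left: "c \<in> prime_field \<Longrightarrow> tr_symp (scale_pair c v) w = c * tr_symp v w"
  by (cases v; cases w)
     (simp add: tr_symp_def scalar_product_def flip: abs_trace_mult,
      simp add: sum_distrib_left right_diff_distrib mult_ac)

lemma tr_symp_scale_right: "c \<in> prime_field \<Longrightarrow> tr_symp w (scale_pair c v) = c * tr_symp w v"
  using tr_symp_antisym[of w] tr_symp_scale_left[of c v w] by simp

lemma tr_symp_0 [simp]: "tr_symp 0 w = 0" "tr_symp w 0 = 0"
  by (simp_all add: tr_symp_site)

lemma tr_symp_diff_left: "tr_symp (u - v) w = tr_symp u w - tr_symp v w"
  using tr_symp_add_left[of "u - v" v w] by simp

lemma tr_symp_nondegenerate:
  assumes "v \<noteq> 0" shows "\<exists>w. tr_symp w v \<noteq> 0"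
proof -
  obtain i where i: "site v i \<noteq> 0" using assms site_eqI[of v 0] by auto
  then obtain y where y: "site_form y (site v i) \<noteq> 0" using site_form_nondegenerate by blast
  have "tr_symp (of_sites (\<lambda>j. if j = i then y else 0)) v
      = (\<Sum>j\<in>UNIV. if j = i then site_form y (site v i) else 0)"
    unfolding tr_symp_site by (rule sum.cong) auto
  then have "tr_symp (of_sites (\<lambda>j. if j = i then y else 0)) v \<noteq> 0" using y by simp
  then show ?thesis by blast
qed

section \<open>Symplectic duals of additive codes and their orders\<close>

lemma mem_symp_dual: "v \<in> symp_dual S \<longleftrightarrow> (\<forall>c\<in>S. tr_symp v c = 0)"
  by (simp add: symp_dual_def)

lemma subgroup_symp_dual: "add_subgroup (symp_dual S)"
  by (simp add: add_subgroup_def mem_symp_dual tr_symp_diff_left)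

lemma symp_dualI: "(\<And>c. c \<in> S \<Longrightarrow> tr_symp v c = 0) \<Longrightarrow> v \<in> symp_dual S"
  by (simp add: mem_symp_dual)

lemma symp_dualD: "v \<in> symp_dual S \<Longrightarrow> c \<in> S \<Longrightarrow> tr_symp v c = 0"
  by (simp add: mem_symp_dual)

lemma tr_symp_eq_0_commute: "tr_symp v w = 0 \<longleftrightarrow> tr_symp w v = 0"
  using tr_symp_antisym[of v w] by simp

lemma symp_dual_antimono: "S \<subseteq> T \<Longrightarrow> symp_dual T \<subseteq> symp_dual S"
  unfolding symp_dual_def by blast

lemma symp_dual_adjoin:
  assumes "add_subgroup S"
  shows "symp_dual (pairs.adjoin S v) = {w \<in> symp_dual S. tr_symp w v = 0}"
proof
  show "symp_dual (pairs.adjoin S v) \<subseteq> {w \<in> symp_dual S. tr_symp w v = 0}"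
    using pairs.subset_adjoin[of S v] pairs.mem_adjoin[OF assms, of v] by (auto simp: mem_symp_dual)
  show "{w \<in> symp_dual S. tr_symp w v = 0} \<subseteq> symp_dual (pairs.adjoin S v)"
  proof (intro subsetI symp_dualI)
    fix w x assume w: "w \<in> {w \<in> symp_dual S. tr_symp w v = 0}" and "x \<in> pairs.adjoin S v"
    then obtain s c where "s \<in> S" "c \<in> prime_field" "x = s + scale_pair c v"
      by (elim pairs.adjoinE)
    with w show "tr_symp w x = 0"
      using symp_dualD[of w S s] by (simp add: tr_symp_add_right tr_symp_scale_right)
  qed
qed

text \<open>The functional \<open>tr_symp _ v\<close> takes values in a field of \<open>p\<close>
  elements; being nonzero on \<open>T\<close>, it has a kernel of index \<open>p\<close>
  there.\<close>

lemma card_inter_perp: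
  assumes "add_subgroup T" "t \<in> T" "tr_symp t v \<noteq> 0"
  shows "CHAR('a) * card {w \<in> T. tr_symp w v = 0} = card (T :: (('a::finite_field^'n) \<times> ('a^'n)) set)"
proof -
  note ker = pairs.adjoin_kernel[of T t "\<lambda>w. tr_symp w v", OF assms tr_symp_add_left tr_symp_scale_left tr_symp_prime_field]
  show ?thesis using pairs.card_adjoin[OF ker(3,2)] ker(1) by simp
qed

text \<open>The quantity \<open>|S| |S\<^sup>\<bottom>|\<close> does not decrease when an element is adjoined to \<open>S\<close>, and it has
  the same value for \<open>S = {0}\<close> and for the whole space.\<close>

lemma card_symp_dual_adjoin:
  fixes v :: "('a::finite_field^'n) \<times> ('a^'n)"
  assumes "add_subgroup S" "v \<notin> S"
  shows "card S * card (symp_dual S) \<le> card (pairs.adjoin S v) * card (symp_dual (pairs.adjoin S v))"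
proof (cases "\<forall>t\<in>symp_dual S. tr_symp t v = 0")
  case True
  then have "symp_dual (pairs.adjoin S v) = symp_dual S" using symp_dual_adjoin[OF assms(1)] by auto
  then show ?thesis using pairs.card_adjoin[OF assms] CHAR_pos[where 'a='a] by (simp del: CHAR_pos)
next
  case False
  then obtain t where t: "t \<in> symp_dual S" "tr_symp t v \<noteq> 0" by blast
  show ?thesis
    using card_inter_perp[OF subgroup_symp_dual t] pairs.card_adjoin[OF assms]
    by (simp add: symp_dual_adjoin[OF assms(1)] algebra_simps)
qed

lemma card_symp_dual_mono:
  fixes S T :: "(('a::finite_field^'n) \<times> ('a^'n)) set"
  assumes "add_subgroup S" "add_subgroup T" "S \<subseteq> T"
  shows "card S * card (symp_dual S) \<le> card T * card (symp_dual T)"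
  by (rule pairs.subgroup_induct[OF assms])
     (auto intro: order_trans[OF _ card_symp_dual_adjoin])

lemma card_symp_dual:
  fixes S :: "(('a::finite_field^'n) \<times> ('a^'n)) set"
  assumes S: "add_subgroup S"
  shows "card S * card (symp_dual S) = CARD('a) ^ (2 * CARD('n))"
proof -
  have U: "card (UNIV :: (('a^'n) \<times> ('a^'n)) set) = CARD('a) ^ (2 * CARD('n))"
    by (simp add: card_prod CARD_vec mult_2 power_add)
  have d0: "symp_dual {0 :: ('a^'n) \<times> ('a^'n)} = UNIV" by (simp add: symp_dual_def)
  \<comment> \<open>Non-degeneracy makes the dual of the whole space trivial, so both ends of the
    squeeze equal \<open>q^(2n)\<close>.\<close>
  have "v = 0" if "v \<in> symp_dual UNIV" for v :: "('a^'n) \<times> ('a^'n)"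
    using tr_symp_nondegenerate[of v] symp_dualD[OF that] tr_symp_eq_0_commute[of v] by blast
  then have dU: "symp_dual (UNIV :: (('a^'n) \<times> ('a^'n)) set) = {0}"
    using add_subgroup_0[OF subgroup_symp_dual] by blast
  show ?thesis
    using card_symp_dual_mono[OF pairs.subgroup_zero S] card_symp_dual_mono[OF S pairs.subgroup_UNIV]
      add_subgroup_0[OF S] U d0 dU by simp
qed

text \<open>One inclusion is formal. Counting for \<open>S\<close> and for its dual shows that
  \<open>S\<close> and its double dual have the same order.\<close>

lemma symp_dual_symp_dual:
  fixes S :: "(('a::finite_field^'n) \<times> ('a^'n)) set"
  assumes S: "add_subgroup S" shows "symp_dual (symp_dual S) = S"
proof -
  have sub: "S \<subseteq> symp_dual (symp_dual S)"
    using tr_symp_eq_0_commute symp_dualD by (blast intro: symp_dualI)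
  have "card S * card (symp_dual S) = card (symp_dual (symp_dual S)) * card (symp_dual S)"
    using card_symp_dual[OF S] card_symp_dual[OF subgroup_symp_dual[of S]] by (simp add: mult.commute)
  moreover have "card (symp_dual S) \<noteq> 0"
    using add_subgroup_0[OF subgroup_symp_dual[of S]] by auto
  ultimately have "card (symp_dual (symp_dual S)) \<le> card S" by simp
  then show ?thesis using card_seteq[OF _ sub] by simp
qed

section \<open>Radicals and hyperbolic planes\<close>

definition symp_radical :: "(('a::finite_field^'n) \<times> ('a^'n)) set \<Rightarrow> (('a^'n) \<times> ('a^'n)) set" where
  "symp_radical S = S \<inter> symp_dual S"

lemma subgroup_symp_radical: "add_subgroup S \<Longrightarrow> add_subgroup (symp_radical S)"
  by (simp add: symp_radical_def add_subgroup_Int subgroup_symp_dual)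

lemma symp_radical_symp_dual: "add_subgroup S \<Longrightarrow> symp_radical (symp_dual S) = symp_radical S"
  by (auto simp: symp_radical_def symp_dual_symp_dual)

lemma symp_radical_isotropic: "symp_radical S \<subseteq> symp_dual (symp_radical S)"
  by (auto simp: symp_radical_def mem_symp_dual)

text \<open>As \<open>x\<close> is outside of \<open>G\<close>, which is its own double dual, some
  \<open>y\<close> in the dual of \<open>G\<close> is not orthogonal to \<open>x\<close>. The plane
  spanned by \<open>x\<close> and \<open>y\<close> is non-degenerate and orthogonal to
  \<open>G\<close>, so adding it leaves the radical unchanged.\<close>

lemma extend_hyperbolic:
  fixes G :: "(('a::finite_field^'n) \<times> ('a^'n)) set"
  assumes G: "add_subgroup G" and x: "x \<in> symp_dual G" "x \<notin> G"
  obtains G' where "add_subgroup G'" "G \<subseteq> G'" "x \<in> G'" "symp_radical G' = symp_radical G"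
    "card G' = CHAR('a)\<^sup>2 * card G" "G' \<subseteq> symp_dual (symp_radical G)"
proof -
  have "x \<notin> symp_dual (symp_dual G)" using x symp_dual_symp_dual[OF G] by simp
  then obtain y where y: "y \<in> symp_dual G" and xy: "tr_symp x y \<noteq> 0" by (auto simp: mem_symp_dual)
  have yx: "tr_symp y x \<noteq> 0" using xy tr_symp_antisym[of y x] by simp
  define H where "H = pairs.adjoin G x"
  define G' where "G' = pairs.adjoin H y"
  have H: "add_subgroup H" unfolding H_def by (rule pairs.subgroup_adjoin[OF G])
  have G': "add_subgroup G'" unfolding G'_def by (rule pairs.subgroup_adjoin[OF H])
  have GH: "G \<subseteq> H" "x \<in> H" "H \<subseteq> G'" "y \<in> G'"
    unfolding G'_def using pairs.mem_adjoin[OF H]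
    by (simp_all add: H_def pairs.subset_adjoin pairs.mem_adjoin[OF G])
  have orth: "tr_symp g x = 0" "tr_symp g y = 0" if "g \<in> G" for g
    using that x y tr_symp_antisym[of g] by (auto simp: mem_symp_dual)
  have Hx: "tr_symp h x = 0" if h: "h \<in> H" for h
  proof -
    obtain s c where "s \<in> G" "c \<in> prime_field" "h = s + scale_pair c x"
      using h unfolding H_def by (elim pairs.adjoinE)
    then show ?thesis by (simp add: tr_symp_add_left tr_symp_scale_left orth)
  qed
  have yH: "y \<notin> H" using Hx yx by blast
  have c: "card G' = CHAR('a)\<^sup>2 * card G"
    using pairs.card_adjoin[OF H yH] pairs.card_adjoin[OF G x(2)]
    by (simp add: G'_def H_def power2_eq_square)
  have "symp_radical G' \<subseteq> symp_radical G"
  proof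
    fix z assume z: "z \<in> symp_radical G'"
    then have "z \<in> G'" by (simp add: symp_radical_def)
    then obtain h l where h: "h \<in> H" "l \<in> prime_field" "z = h + scale_pair l y"
      unfolding G'_def by (elim pairs.adjoinE)
    \<comment> \<open>Pairing with \<open>x\<close> isolates the coefficient of \<open>z\<close> at
      \<open>y\<close>; pairing with \<open>y\<close> below isolates the one at
      \<open>x\<close>.\<close>
    have "tr_symp z x = 0" using z GH by (auto simp: symp_radical_def mem_symp_dual)
    then have "l = 0" using h yx by (simp add: tr_symp_add_left tr_symp_scale_left Hx)
    then have "z \<in> H" using h by (simp flip: zero_prod_def)
    then obtain g k where g: "g \<in> G" "k \<in> prime_field" "z = g + scale_pair k x"
      unfolding H_def by (elim pairs.adjoinE)
    have "tr_symp z y = 0" using z GH by (auto simp: symp_radical_def mem_symp_dual)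
    then have "k = 0" using g xy by (simp add: tr_symp_add_left tr_symp_scale_left orth)
    then have "z \<in> G" using g by (simp flip: zero_prod_def)
    then show "z \<in> symp_radical G" using z GH by (auto simp: symp_radical_def mem_symp_dual)
  qed
  moreover have sub: "G' \<subseteq> symp_dual (symp_radical G)"
    unfolding G'_def H_def
  proof (intro pairs.adjoin_least subgroup_symp_dual)
    show "G \<subseteq> symp_dual (symp_radical G)"
      unfolding symp_radical_def using tr_symp_eq_0_commute symp_dualD by (blast intro: symp_dualI)
    show "x \<in> symp_dual (symp_radical G)" "y \<in> symp_dual (symp_radical G)"
      using x y by (auto simp: symp_radical_def mem_symp_dual)
  qed
  moreover have "symp_radical G \<subseteq> symp_dual G'"
    using symp_dual_antimono[OF sub] symp_dual_symp_dual[OF subgroup_symp_radical[OF G]] by simp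
  then have "symp_radical G \<subseteq> symp_radical G'" using GH by (auto simp: symp_radical_def)
  ultimately show ?thesis using that[of G'] G' GH c by blast
qed


text \<open>Order times order of the dual is \<open>q^(2n)\<close> for \<open>D\<close> and for
  \<open>G\<close>, so the dual loses the factor that \<open>G\<close> gains.\<close>

lemma card_symp_dual_isotropic:
  fixes D G :: "(('a::finite_field^'n) \<times> ('a^'n)) set"
  assumes D: "add_subgroup D" and m: "card (symp_dual D) = CHAR('a) ^ (2 * m) * card D"
    and G: "add_subgroup G" "card G = CHAR('a) ^ (2 * i) * card D" and "i \<le> m"
  shows "card (symp_dual G) = CHAR('a) ^ (2 * (m - i)) * card D"
proof -
  have "card D > 0" using add_subgroup_0[OF D] by (auto simp: card_gt_0_iff)
  moreover have "card G * card (symp_dual G) = card D * card (symp_dual D)"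
    using card_symp_dual[OF D] card_symp_dual[OF G(1)] by simp
  moreover have "CHAR('a) ^ (2 * i) * CHAR('a) ^ (2 * (m - i)) = CHAR('a) ^ (2 * m)"
    using \<open>i \<le> m\<close> by (simp add: diff_mult_distrib2 flip: power_add)
  ultimately have "CHAR('a) ^ (2 * i) * (card D * card (symp_dual G))
      = CHAR('a) ^ (2 * i) * (card D * (CHAR('a) ^ (2 * (m - i)) * card D))"
    using m G(2) by (simp add: ac_simps)
  then show ?thesis using add_subgroup_0[OF D] by auto
qed

text \<open>Hyperbolic planes are added to \<open>D\<close> one by one, the first of them through
  \<open>x\<close>. While \<open>i < m\<close>, the dual of \<open>G\<close> has more elements than
  the radical \<open>D\<close>, and an element of it outside of \<open>D\<close> starts the next
  plane. The dual of such a \<open>G\<close> has the same radical but avoids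
  \<open>x\<close>.\<close>

lemma hyperbolic_tower:
  fixes D :: "(('a::finite_field^'n) \<times> ('a^'n)) set"
  assumes D: "add_subgroup D" "D \<subseteq> symp_dual D" and x: "x \<in> symp_dual D" "x \<notin> D"
    and m: "card (symp_dual D) = CHAR('a) ^ (2 * m) * card D" and "1 \<le> i" "i \<le> m"
  shows "\<exists>G. add_subgroup G \<and> x \<in> G \<and> symp_radical G = D \<and> card G = CHAR('a) ^ (2 * i) * card D"
  using \<open>1 \<le> i\<close> \<open>i \<le> m\<close>
proof (induction i rule: dec_induct)
  case base
  have "symp_radical D = D" using D by (auto simp: symp_radical_def)
  then obtain G where "add_subgroup G" "x \<in> G" "symp_radical G = D" "card G = (CHAR('a))\<^sup>2 * card D"
    using extend_hyperbolic[OF D(1) x] by metis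
  then show ?case by auto
next
  case (step i)
  then obtain G where G: "add_subgroup G" "x \<in> G" "symp_radical G = D" "card G = CHAR('a) ^ (2 * i) * card D"
    by auto
  have p: "CHAR('a) > 1" by (rule CHAR_gt_1)
  have "card D > 0" using add_subgroup_0[OF D(1)] by (auto simp: card_gt_0_iff)
  moreover have "CHAR('a) ^ (2 * (m - i)) > 1"
    using p step by (intro one_less_power) auto
  ultimately have "card D < card (symp_dual G)"
    using card_symp_dual_isotropic[OF D(1) m G(1,4)] step by simp
  then have "\<not> symp_dual G \<subseteq> D" using card_mono[of D "symp_dual G"] by auto
  then obtain y where "y \<in> symp_dual G" "y \<notin> D" by blast
  then have y: "y \<in> symp_dual G" "y \<notin> G" using G(3) by (auto simp: symp_radical_def)
  obtain G' where "add_subgroup G'" "G \<subseteq> G'" "symp_radical G' = symp_radical G" "card G' = (CHAR('a))\<^sup>2 * card G"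
    using extend_hyperbolic[OF G(1) y] by metis
  with G show ?case by (intro exI[of _ G']) (auto simp: power2_eq_square)
qed

text \<open>A hyperbolic plane through \<open>e\<close> is added to \<open>D\<close>, giving
  \<open>G\<close>, and the new generator is taken from the dual of \<open>G\<close>. Then
  \<open>D'\<close> stays in that dual, hence is orthogonal to \<open>e\<close>, and it cannot
  contain \<open>e\<close> because \<open>G\<close> meets its dual in \<open>D\<close> only.\<close>

lemma enlarge_isotropic:
  fixes D :: "(('a::finite_field^'n) \<times> ('a^'n)) set"
  assumes D: "add_subgroup D" "D \<subseteq> symp_dual D" and e: "e \<in> symp_dual D" "e \<notin> D"
    and m: "card (symp_dual D) = CHAR('a) ^ (2 * Suc m) * card D" and "m \<ge> 1"
  obtains D' where "add_subgroup D'" "D \<subseteq> D'" "D' \<subseteq> symp_dual D'" "e \<in> symp_dual D'" "e \<notin> D'"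
    "card D' = CHAR('a) * card D"
proof -
  obtain G where G: "add_subgroup G" "e \<in> G" "symp_radical G = D" "card G = CHAR('a) ^ (2 * 1) * card D"
    using hyperbolic_tower[OF D e m, of 1] by auto
  have p: "CHAR('a) > 1" by (rule CHAR_gt_1)
  have "card D > 0" using add_subgroup_0[OF D(1)] by (auto simp: card_gt_0_iff)
  moreover have "CHAR('a) ^ (2 * (Suc m - 1)) > 1"
    using p \<open>m \<ge> 1\<close> by (intro one_less_power) auto
  ultimately have "card D < card (symp_dual G)"
    using card_symp_dual_isotropic[OF D(1) m G(1,4)] by simp
  then have "\<not> symp_dual G \<subseteq> D" using card_mono[of D "symp_dual G"] by auto
  then obtain y where y: "y \<in> symp_dual G" "y \<notin> D" by blast
  define D' where "D' = pairs.adjoin D y"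
  have dual: "symp_dual D' = {w \<in> symp_dual D. tr_symp w y = 0}"
    unfolding D'_def by (rule symp_dual_adjoin[OF D(1)])
  have DG: "D \<subseteq> G" "D \<subseteq> symp_dual G" using G(3) by (auto simp: symp_radical_def)
  have yD: "y \<in> symp_dual D" using y symp_dual_antimono[OF DG(1)] by blast
  have sub: "D' \<subseteq> symp_dual G"
    unfolding D'_def by (intro pairs.adjoin_least subgroup_symp_dual DG y)
  show ?thesis
  proof (rule that)
    show "add_subgroup D'" "D \<subseteq> D'" "card D' = CHAR('a) * card D"
      by (simp_all add: D'_def pairs.subgroup_adjoin pairs.subset_adjoin pairs.card_adjoin D y)
    have "D \<subseteq> symp_dual D'" 
      using D yD tr_symp_eq_0_commute symp_dualD unfolding dual by blast
    moreover have "y \<in> symp_dual D'" using yD by (simp add: dual)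
    ultimately show "D' \<subseteq> symp_dual D'"
      by (subst D'_def) (intro pairs.adjoin_least subgroup_symp_dual)
    show "e \<in> symp_dual D'" using e G(2) y tr_symp_eq_0_commute symp_dualD unfolding dual by blast
    show "e \<notin> D'" using sub G e by (auto simp: symp_radical_def)
  qed
qed


section \<open>Cosets of large minimum weight\<close>

abbreviation support :: "('a::finite_field^'n) \<times> ('a^'n) \<Rightarrow> 'n set" where
  "support v \<equiv> {i. site v i \<noteq> 0}"

lemma swt_eq_0_iff: "swt v = 0 \<longleftrightarrow> v = 0"
  using site_eqI[of v 0] by (auto simp: swt_site)

lemma swt_diff_le: "swt (v - w) \<le> swt v + swt w"
  unfolding swt_site by (rule order_trans[OF card_mono card_Un_le]) auto

lemma swt_scale: "c \<noteq> 0 \<Longrightarrow> swt (scale_pair c v) = swt v"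
  by (simp add: swt_def)

text \<open>The chain \<open>\<delta> \<le> swt u \<le> w + (w - 1) \<le> \<delta>\<close> must
  consist of equalities. In particular the exception arises only for
  \<open>2 * w = \<delta> + 1\<close>.\<close>

lemma low_weight_in_coset:
  fixes t u :: "('a::finite_field^'n) \<times> ('a^'n)"
  assumes u: "\<delta> \<le> swt u" and t: "swt t = w" and w: "2 * w \<le> \<delta> + 1" and low: "swt (t + u) < w"
  shows "swt u = \<delta>" "support t \<inter> support (t + u) = {}" "card (support (t + u)) < w"
proof -
  let ?S = "support (t + u)"
  have "support u \<subseteq> support t \<union> (?S - support t)" by auto
  then have "swt u \<le> card (support t \<union> (?S - support t))"
    unfolding swt_site by (intro card_mono) auto
  also have "\<dots> \<le> w + card (?S - support t)"
    using card_Un_le[of "support t" "?S - support t"] t by (simp add: swt_site)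
  finally have le: "swt u \<le> w + card (?S - support t)" .
  have S: "card ?S < w" using low by (simp add: swt_site)
  have le2: "card (?S - support t) \<le> card ?S" by (intro card_mono) auto
  show "card ?S < w" by fact
  show "swt u = \<delta>" using le le2 S u w by linarith
  have "card (?S - support t) = card ?S" using le le2 S u w by linarith
  then have "?S - support t = ?S" by (intro card_subset_eq) auto
  then show "support t \<inter> ?S = {}" by auto
qed

text \<open>When every word of minimum weight of the dual lies in \<open>D\<close>, there are words \<open>t\<close> of weight
  \<open>w = \<lceil>\<delta>/2\<rceil>\<close> of minimum weight in their coset: of two candidates that differ in one site by the
  entry of \<open>e\<close>, one works, since otherwise there are two words of weight \<open>\<delta>\<close> in \<open>D\<close> whose
  supports meet only where the candidates live, and they are not orthogonal.\<close>

lemma exists_coset_leader: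
  fixes D :: "(('a::finite_field^'n) \<times> ('a^'n)) set"
  assumes D: "D \<subseteq> symp_dual D"
    and \<delta>: "\<And>v. v \<in> symp_dual D \<Longrightarrow> v \<noteq> 0 \<Longrightarrow> \<delta> \<le> swt v"
    and min_D: "\<And>v. v \<in> symp_dual D \<Longrightarrow> swt v = \<delta> \<Longrightarrow> v \<in> D"
    and e: "e \<in> D" "swt e = \<delta>" and w: "1 \<le> w" "2 * w \<le> \<delta> + 1"
  obtains t where "tr_symp t e \<noteq> 0" "\<And>u. u \<in> symp_dual D \<Longrightarrow> w \<le> swt (t + u)"
proof -
  have "w \<le> card (support e)" using w e by (simp add: swt_site)
  then obtain W where W: "W \<subseteq> support e" "card W = w" by (meson obtain_subset_with_card_n)
  then obtain i where i: "i \<in> W" using w by fastforce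
  define b where "b = site e i"
  have b: "b \<noteq> 0" using i W by (auto simp: b_def)
  \<comment> \<open>The candidates will have entry \<open>a\<close> or \<open>a + b\<close> at site
    \<open>i\<close>. Both pair non-trivially with \<open>b\<close>, since the form is
    alternating.\<close>
  obtain a where a: "site_form a b \<noteq> 0" using site_form_nondegenerate[OF b] by blast
  have ab: "site_form (a + b) b \<noteq> 0" using a by (simp add: site_form_add_left)
  define t where "t c = of_sites (\<lambda>j. if j = i then c else if j \<in> W then site e j else 0)" for c
  have t_site: "site (t c) j = (if j = i then c else if j \<in> W then site e j else 0)" for c j
    by (simp add: t_def)
  have t_e: "tr_symp (t c) e = site_form c b" for c
  proof -
    have "tr_symp (t c) e = (\<Sum>j\<in>UNIV. if j = i then site_form c b else 0)"
      unfolding tr_symp_site by (rule sum.cong) (auto simp: t_site b_def)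
    then show ?thesis by simp
  qed
  have t_supp: "support (t c) = W" if "c \<noteq> 0" for c
    using that i W by (auto simp: t_site)
  \<comment> \<open>A failing candidate yields a minimum-weight word \<open>u\<close>, hence an
    element of \<open>D\<close>, that cancels the candidate on \<open>W\<close> and has fewer than
    \<open>w\<close> nonzero sites elsewhere.\<close>
  have low: "swt u = \<delta> \<and> u \<in> D \<and> (\<forall>j\<in>W. site u j = - site (t c) j) \<and> (\<forall>j. j \<notin> W \<longrightarrow> site u j = site (t c + u) j)
      \<and> W \<inter> support (t c + u) = {} \<and> card (support (t c + u)) < w"
    if c: "c \<noteq> 0" and u: "u \<in> symp_dual D" and lt: "swt (t c + u) < w" for c u
  proof -
    have tw: "swt (t c) = w" using t_supp[OF c] W by (simp add: swt_site)
    then have "u \<noteq> 0" using lt by auto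
    then have "\<delta> \<le> swt u" using \<delta> u by blast
    note l = low_weight_in_coset[OF this tw w(2) lt]
    have "site u j = - site (t c) j" if "j \<in> W" for j
    proof -
      have "site (t c + u) j = 0" using l(2) that t_supp[OF c] by blast
      then show ?thesis by (simp add: eq_neg_iff_add_eq_0 add.commute)
    qed
    moreover have "site u j = site (t c + u) j" if "j \<notin> W" for j using that i by (auto simp: t_site)
    ultimately show ?thesis using l min_D[OF u] t_supp[OF c] by blast
  qed
  have "(\<forall>u\<in>symp_dual D. w \<le> swt (t a + u)) \<or> (\<forall>u\<in>symp_dual D. w \<le> swt (t (a + b) + u))"
  proof (rule ccontr)
    assume "\<not> ?thesis"
    then obtain u u' where u: "u \<in> symp_dual D" "swt (t a + u) < w"
      and u': "u' \<in> symp_dual D" "swt (t (a + b) + u') < w" by (meson not_le)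
    have nz: "a \<noteq> 0" "a + b \<noteq> 0" using a ab by auto
    note l = low[OF nz(1) u] and l' = low[OF nz(2) u']
    let ?S = "support (t a + u)" and ?S' = "support (t (a + b) + u')"
    have "site (u - u') i = b" using l l' i by (simp add: t_site)
    then have "u - u' \<noteq> 0" using b by auto
    then have ge: "\<delta> \<le> swt (u - u')" using \<delta> add_subgroup_diff[OF subgroup_symp_dual u(1) u'(1)] by blast
    have eqW: "site u j = site u' j" if "j \<in> W" "j \<noteq> i" for j
      using l l' that by (simp add: t_site)
    have "support (u - u') \<subseteq> insert i (?S \<union> ?S')"
    proof
      fix j assume j: "j \<in> support (u - u')"
      show "j \<in> insert i (?S \<union> ?S')"
      proof (cases "j \<in> W")
        case True then show ?thesis using eqW[of j] j by auto
      next
        case False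
        then have "site u j = site (t a + u) j" "site u' j = site (t (a + b) + u') j" using l l' by blast+
        then show ?thesis using j by auto
      qed
    qed
    then have "swt (u - u') \<le> card (insert i (?S \<union> ?S'))"
      unfolding swt_site by (intro card_mono) auto
    also have "\<dots> \<le> Suc (card (?S \<union> ?S'))" by (rule card_insert_le_m1) auto
    \<comment> \<open>The two remainders have at most \<open>w - 1\<close> sites each, while their
      union needs at least \<open>2 * w - 2\<close>; so they cannot overlap.\<close>
    finally have "2 * w - 1 \<le> Suc (card (?S \<union> ?S'))" using ge w by linarith
    moreover have "card (?S \<union> ?S') + card (?S \<inter> ?S') = card ?S + card ?S'"
      by (rule card_Un_Int[symmetric]) auto
    moreover have "card ?S < w" "card ?S' < w" using l l' by blast+
    ultimately have "card (?S \<inter> ?S') = 0" by linarith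
    then have disj: "?S \<inter> ?S' = {}" by simp
    \<comment> \<open>On the rest of \<open>W\<close> the entries agree and the form is alternating;
      off \<open>W\<close> one of the two entries vanishes. Only site \<open>i\<close> contributes,
      which contradicts isotropy of \<open>D\<close>.\<close>
    have "site_form (site u j) (site u' j) = (if j = i then site_form a b else 0)" for j
    proof (cases "j \<in> W")
      case True
      then show ?thesis
      proof (cases "j = i")
        case True
        have "site u i = - a" "site u' i = - (a + b)" using l l' i by (simp_all add: t_site)
        moreover have "site_form (- a) (- (a + b)) = site_form a b"
          by (simp add: site_form_def algebra_simps)
        ultimately show ?thesis using True by simp
      qed (simp add: eqW)
    next
      case False
      then have "site u j = site (t a + u) j" "site u' j = site (t (a + b) + u') j" using l l' by blast+
      moreover have "site (t a + u) j = 0 \<or> site (t (a + b) + u') j = 0" using disj by blast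
      ultimately have "site u j = 0 \<or> site u' j = 0" by argo
      then show ?thesis using False i by auto
    qed
    then have "tr_symp u u' = site_form a b" unfolding tr_symp_site by simp
    moreover have "tr_symp u u' = 0" using l l' D symp_dualD by blast
    ultimately show False using a by simp
  qed
  then show ?thesis
    using that[of "t a"] that[of "t (a + b)"] a ab t_e by metis
qed


section \<open>The additive character\<close>

text \<open>As \<open>\<omega>^p = 1\<close>, every natural number representing the trace may serve
  as the exponent. Additivity of the character follows without reducing sums modulo
  \<open>p\<close>.\<close>

lemma add_char_eq:
  assumes "of_nat n = abs_trace (x :: 'a::finite_field)"
  shows "add_char x = exp (2 * pi * \<i> / of_nat CHAR('a)) ^ n"
proof -
  let ?z = "exp (2 * pi * \<i> / of_nat CHAR('a)) :: complex" and ?p = "CHAR('a)"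
  have z: "?z ^ ?p = 1" using exp_divide_power_eq[of ?p "2 * pi * \<i>"] CHAR_pos[where 'a='a]
    by (simp del: CHAR_pos)
  have uniq: "k = n mod ?p" if "k < ?p \<and> of_nat k = abs_trace x" for k
  proof -
    have "(of_nat k :: 'a) = of_nat n" using that assms by simp
    then have "k mod ?p = n mod ?p" by (simp add: of_nat_eq_iff_cong_CHAR cong_def)
    then show ?thesis using that by simp
  qed
  have "(of_nat (n mod ?p) :: 'a) = of_nat n" by (simp add: of_nat_eq_iff_cong_CHAR cong_def)
  then have "n mod ?p < ?p \<and> of_nat (n mod ?p) = abs_trace x" using assms by simp
  then have "abs_trace_rep x = n mod ?p" unfolding abs_trace_rep_def by (rule the_equality) (rule uniq)
  moreover have "?z ^ (n mod ?p) = ?z ^ n"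
    by (metis z mod_mult_div_eq power_add power_mult power_one mult_1_right)
  ultimately show ?thesis by (simp add: add_char_def)
qed

lemma abs_trace_of_nat: obtains n where "n < CHAR('a)" "of_nat n = abs_trace (x :: 'a::finite_field)"
  using abs_trace_prime_field[of x] by (metis (no_types, lifting) imageE lessThan_iff prime_field_eq)

lemma add_char_add: "add_char (x + y :: 'a::finite_field) = add_char x * add_char y"
proof -
  obtain n m where "of_nat n = abs_trace x" "of_nat m = abs_trace y" by (metis abs_trace_of_nat)
  then show ?thesis using add_char_eq[of n x] add_char_eq[of m y] add_char_eq[of "n + m" "x + y"]
    by (simp add: abs_trace_add power_add)
qed

lemma add_char_nonzero [simp]: "add_char x \<noteq> 0"
  by (simp add: add_char_def)

lemma add_char_eq_1_iff: "add_char (x :: 'a::finite_field) = 1 \<longleftrightarrow> abs_trace x = 0"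
proof -
  obtain n where n: "n < CHAR('a)" "of_nat n = abs_trace x" by (rule abs_trace_of_nat)
  have "add_char x = exp (2 * pi * \<i> * of_nat n / of_nat CHAR('a))"
    by (simp add: add_char_eq[OF n(2)] flip: exp_of_nat_mult) (simp add: mult_ac)
  moreover have "1 \<le> CHAR('a)" using CHAR_pos[where 'a='a] by linarith
  ultimately have "add_char x = 1 \<longleftrightarrow> CHAR('a) dvd n"
    using complex_root_unity_eq_1[of "CHAR('a)" n] by simp
  also have "\<dots> \<longleftrightarrow> abs_trace x = 0" by (simp flip: n(2) add: of_nat_eq_0_iff_char_dvd)
  finally show ?thesis .
qed

lemma add_char_0 [simp]: "add_char 0 = 1"
  by (simp add: add_char_eq_1_iff abs_trace_0)

lemma add_char_sum: "add_char (sum f A) = (\<Prod>i\<in>A. add_char (f i))"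
  by (induction A rule: infinite_finite_induct) (auto simp: add_char_add)


section \<open>Products, eigenvectors and traces of error operators\<close>

abbreviation act :: "('a::finite_field^'n) \<times> ('a^'n) \<Rightarrow> complex^('a^'n) \<Rightarrow> complex^('a^'n)" where
  "act v \<psi> \<equiv> error_op v *v \<psi>"

lemma scalar_product_add:
  "scalar_product x (y + z) = scalar_product x y + scalar_product x (z :: 'a::finite_field^'n)"
  "scalar_product (y + z) x = scalar_product y x + scalar_product z (x :: 'a::finite_field^'n)"
  by (simp_all add: scalar_product_def algebra_simps sum.distrib)

lemma prod_of_bool: "finite A \<Longrightarrow> (\<Prod>i\<in>A. if P i then f i else 0) = (if \<forall>i\<in>A. P i then prod f A else (0::complex))"
  by (induction A rule: finite_induct) auto

text \<open>An error operator is a shift of coordinates with phases. This form replaces the tensor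
  products of matrices from here on.\<close>

lemma act_nth:
  fixes v :: "('a::finite_field^'n) \<times> ('a^'n)"
  shows "act v \<psi> $ y = add_char (scalar_product (snd v) (y - fst v)) * \<psi> $ (y - fst v)"
proof -
  have X: "tensor_op (\<lambda>i. X_op (fst v $ i)) $ y $ x = (if x = y - fst v then 1 else 0)" for x y
    by (auto simp: tensor_op_def X_op_def prod_of_bool vec_eq_iff)
  have Z: "tensor_op (\<lambda>i. Z_op (snd v $ i)) $ y $ x
      = (if y = x then add_char (scalar_product (snd v) x) else 0)" for x y
    by (auto simp: tensor_op_def Z_op_def prod_of_bool vec_eq_iff scalar_product_def add_char_sum)
  have "error_op v $ y $ x
      = (if x = y - fst v then add_char (scalar_product (snd v) (y - fst v)) else 0)" for x y
    by (simp add: error_op_def matrix_matrix_mult_def X Z if_distrib[of "\<lambda>z. z * _"] cong: if_cong)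
  then show ?thesis
    by (simp add: matrix_vector_mult_def if_distrib[of "\<lambda>z. z * _"] cong: if_cong)
qed

lemma act_scale: "act v (c *s \<psi>) = c *s act v \<psi>"
  by (simp add: vec_eq_iff act_nth)

lemma act_sum: "act v (sum f A) = (\<Sum>x\<in>A. act v (f x))"
  by (simp add: vec_eq_iff act_nth sum_distrib_left)

lemma act_0 [simp]: "act 0 \<psi> = \<psi>"
  by (simp add: vec_eq_iff act_nth scalar_product_def)

lemma act_act: "act v (act w \<psi>) = add_char (scalar_product (snd v) (fst w)) *s act (v + w) \<psi>"
proof (unfold vec_eq_iff, intro allI)
  fix y
  have "scalar_product (snd v) (y - fst v)
      = scalar_product (snd v) (fst w) + scalar_product (snd v) (y - fst v - fst w)"
    by (simp flip: scalar_product_add)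
  then show "act v (act w \<psi>) $ y = (add_char (scalar_product (snd v) (fst w)) *s act (v + w) \<psi>) $ y"
    by (simp add: act_nth scalar_product_add add_char_add diff_diff_eq)
qed

lemma act_commute:
  "\<exists>c. act v (act w \<psi>) = c *s act w (act v \<psi>) \<and> c \<noteq> 0 \<and> (c = 1 \<longleftrightarrow> tr_symp v w = 0)"
proof -
  let ?a = "scalar_product (snd v) (fst w)" and ?b = "scalar_product (snd w) (fst v)"
  define c where "c = add_char (?a - ?b)"
  have "add_char ?a = c * add_char ?b" unfolding c_def by (simp flip: add_char_add)
  then have "act v (act w \<psi>) = c *s act w (act v \<psi>)" by (simp add: act_act add.commute)
  moreover have "tr_symp v w = abs_trace (?a - ?b)"
    by (cases v; cases w) (simp add: tr_symp_def scalar_product_def mult.commute)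
  ultimately show ?thesis by (auto simp: c_def add_char_eq_1_iff)
qed

lemma act_commute_orth: "tr_symp v w = 0 \<Longrightarrow> act v (act w \<psi>) = act w (act v \<psi>)"
  using act_commute[of v w \<psi>] by auto

section \<open>Invertibility and joint eigenvectors of error operators\<close>

lemma act_uminus: "\<exists>c. c \<noteq> 0 \<and> act (- v) (act v \<psi>) = c *s \<psi>"
  using act_act[of "- v" v \<psi>]
  by (intro exI[of _ "add_char (scalar_product (snd (- v)) (fst v))"]) simp

lemma act_nonzero: "\<psi> \<noteq> 0 \<Longrightarrow> act v \<psi> \<noteq> 0"
  using act_uminus[of v \<psi>] by (auto simp: act_scale[of _ 0 0, simplified])

text \<open>Up to a phase, the operator of \<open>v\<close> is that of \<open>v - w\<close> after
  that of \<open>w\<close>, whose eigenvalue is nonzero. Hence being an eigenvector need only be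
  checked on generators.\<close>

lemma subgroup_eigen:
  "add_subgroup {v. \<exists>c. act v \<psi> = c *s \<psi>}"
proof (cases "\<psi> = 0")
  case True
  then show ?thesis using act_scale[of _ 0 0] by (simp add: add_subgroup_def)
next
  case nz: False
  show ?thesis
    unfolding add_subgroup_def
  proof (intro conjI ballI CollectI)
    show "\<exists>c. act 0 \<psi> = c *s \<psi>" by (intro exI[of _ 1]) simp
    fix v w assume "v \<in> {v. \<exists>c. act v \<psi> = c *s \<psi>}" "w \<in> {v. \<exists>c. act v \<psi> = c *s \<psi>}"
    then obtain c d where c: "act v \<psi> = c *s \<psi>" and d: "act w \<psi> = d *s \<psi>" by blast
    have "d \<noteq> 0" using act_nonzero[OF nz, of w] d by auto
    define k where "k = add_char (scalar_product (snd (v - w)) (fst w))"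
    have "act (v - w) (act w \<psi>) = k *s act v \<psi>"
      using act_act[of "v - w" w \<psi>] by (simp add: k_def)
    then have "d *s act (v - w) \<psi> = (k * c) *s \<psi>" by (simp add: c d act_scale)
    then have "(1 / d) *s (d *s act (v - w) \<psi>) = (k * c / d) *s \<psi>" by simp
    then show "\<exists>c. act (v - w) \<psi> = c *s \<psi>" using \<open>d \<noteq> 0\<close> by auto
  qed
qed

definition joint_eigenvector :: "(('a::finite_field^'n) \<times> ('a^'n)) set \<Rightarrow> complex^('a^'n) \<Rightarrow> bool" where
  "joint_eigenvector D \<psi> \<longleftrightarrow> \<psi> \<noteq> 0 \<and> (\<forall>v\<in>D. \<exists>c. act v \<psi> = c *s \<psi>)"

lemma act_funpow_commute:
  assumes "tr_symp u v = 0" shows "act u ((act v ^^ k) \<psi>) = (act v ^^ k) (act u \<psi>)"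
proof (induction k)
  case (Suc k)
  then show ?case using act_commute_orth[OF assms, of "(act v ^^ k) \<psi>"] by simp
qed simp

lemma act_funpow_scale: "(act v ^^ k) (c *s \<psi>) = c *s (act v ^^ k) \<psi>"
  by (induction k) (auto simp: act_scale)

text \<open>Since \<open>p\<close> times \<open>v\<close> is zero, only the accumulated phases
  remain; they make up \<open>s\<close>, which need not be 1.\<close>

lemma act_funpow_CHAR:
  fixes v :: "('a::finite_field^'n) \<times> ('a^'n)"
  obtains s where "s \<noteq> 0" "(act v ^^ CHAR('a)) \<psi> = s *s \<psi>"
proof -
  have *: "\<exists>s. s \<noteq> 0 \<and> (act v ^^ k) \<psi> = s *s act (scale_pair (of_nat k) v) \<psi>" for k
  proof (induction k)
    case 0
    show ?case by (intro exI[of _ 1]) (simp flip: zero_prod_def)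
  next
    case (Suc k)
    then obtain s where s: "s \<noteq> 0" "(act v ^^ k) \<psi> = s *s act (scale_pair (of_nat k) v) \<psi>" by blast
    have "v + scale_pair (of_nat k) v = scale_pair (of_nat (Suc k)) v"
      by (simp add: prod_eq_iff vector_sadd_rdistrib)
    then show ?case using act_act[of v "scale_pair (of_nat k) v" \<psi>] s
      by (intro exI[of _ "s * add_char (scalar_product (snd v) (of_nat k *s fst v))"]) (simp add: act_scale)
  qed
  show ?thesis using *[of "CHAR('a)"] that by (auto simp flip: zero_prod_def)
qed

text \<open>The eigenvectors of \<open>T = act v\<close> in the span of the orbit of \<open>\<psi>\<close> are the sums
  \<open>\<Sum> z\<^sup>k T\<^sup>k \<psi>\<close> with \<open>z\<^sup>p\<close> prescribed; a fixed nonzero coordinate of such a sum is a polynomial in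
  \<open>z\<close> of degree below \<open>p\<close>, hence does not vanish for all \<open>p\<close> choices of \<open>z\<close>.\<close>

lemma joint_eigenvector_adjoin:
  fixes v :: "('a::finite_field^'n) \<times> ('a^'n)"
  assumes \<psi>: "joint_eigenvector U \<psi>" and U: "add_subgroup U" and orth: "\<And>u. u \<in> U \<Longrightarrow> tr_symp u v = 0"
  shows "\<exists>\<phi>. joint_eigenvector (pairs.adjoin U v) \<phi>"
proof -
  define T where "T = act v"
  let ?p = "CHAR('a)"
  have p: "?p > 0" by simp
  obtain s where s: "s \<noteq> 0" "(T ^^ ?p) \<psi> = s *s \<psi>" unfolding T_def by (rule act_funpow_CHAR)
  define \<phi> where "\<phi> z = (\<Sum>k<?p. z ^ k *s (T ^^ k) \<psi>)" for z
  obtain y where y: "\<psi> $ y \<noteq> 0" using \<psi> by (auto simp: joint_eigenvector_def vec_eq_iff)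
  define f where "f = (\<Sum>k<?p. monom ((T ^^ k) \<psi> $ y) k)"
  have f: "poly f z = \<phi> z $ y" for z
    by (simp add: f_def \<phi>_def poly_sum poly_monom mult.commute)
  have "coeff f 0 = (\<Sum>k<?p. if k = 0 then \<psi> $ y else 0)"
    unfolding f_def coeff_sum by (rule sum.cong) auto
  also have "\<dots> = \<psi> $ y" by simp
  finally have f0: "f \<noteq> 0" using y by auto
  have "degree f \<le> ?p - 1"
    unfolding f_def by (rule degree_sum_le) (auto intro!: order_trans[OF degree_monom_le])
  then have "degree f < ?p" using p by linarith
  then have "card {z. poly f z = 0} < card {z::complex. z ^ ?p = 1 / s}"
    using card_poly_roots_bound[OF f0] card_nth_roots[of "1 / s" ?p] s p by simp
  then have "\<not> {z. z ^ ?p = 1 / s} \<subseteq> {z. poly f z = 0}"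
    using card_mono[OF poly_roots_finite[OF f0]] by (meson not_less)
  then obtain z where z: "z ^ ?p = 1 / s" "\<phi> z $ y \<noteq> 0" using f by auto
  have "z \<noteq> 0" using z s p by (auto simp: power_0_left)
  have nz: "\<phi> z \<noteq> 0" using z by auto
  let ?g = "\<lambda>k. z ^ k *s (T ^^ k) \<psi>"
  \<comment> \<open>Applying \<open>z T\<close> shifts the summands by one, and the last becomes the
    first because \<open>z^p * s = 1\<close>.\<close>
  have "z *s T (\<phi> z) = (\<Sum>k<?p. ?g (Suc k))"
    unfolding \<phi>_def T_def act_sum by (simp add: act_scale vec.scale_sum_right)
  also have "\<dots> = (\<Sum>k<?p. ?g k)"
  proof -
    have "?g ?p = ?g 0" using s z by simp
    then show ?thesis using sum.lessThan_Suc_shift[of ?g ?p] sum.lessThan_Suc[of ?g ?p] by simp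
  qed
  also have "\<dots> = \<phi> z" by (simp add: \<phi>_def)
  finally have "(1 / z) *s (z *s T (\<phi> z)) = (1 / z) *s \<phi> z" by simp
  then have v: "\<exists>c. act v (\<phi> z) = c *s \<phi> z" using \<open>z \<noteq> 0\<close> by (auto simp: T_def)
  have u: "\<exists>c. act u (\<phi> z) = c *s \<phi> z" if uU: "u \<in> U" for u
  proof -
    obtain c where c: "act u \<psi> = c *s \<psi>" using \<psi> uU by (auto simp: joint_eigenvector_def)
    have "act u (?g k) = c *s ?g k" for k
      using act_funpow_commute[OF orth[OF uU], of k \<psi>]
      by (simp add: act_scale c act_funpow_scale T_def mult.commute)
    then have "act u (\<phi> z) = c *s \<phi> z" by (simp add: \<phi>_def act_sum vec.scale_sum_right)
    then show ?thesis by blast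
  qed
  have "pairs.adjoin U v \<subseteq> {w. \<exists>c. act w (\<phi> z) = c *s \<phi> z}"
    by (rule pairs.adjoin_least[OF subgroup_eigen]) (use u v in blast)+
  then show ?thesis using nz unfolding joint_eigenvector_def by blast
qed

lemma exists_joint_eigenvector:
  fixes D :: "(('a::finite_field^'n) \<times> ('a^'n)) set"
  assumes D: "add_subgroup D" "D \<subseteq> symp_dual D"
  shows "\<exists>\<psi>. joint_eigenvector D \<psi>"
proof -
  have "{0} \<subseteq> D" using add_subgroup_0[OF D(1)] by simp
  show ?thesis
  proof (rule pairs.subgroup_induct[OF pairs.subgroup_zero D(1) \<open>{0} \<subseteq> D\<close>])
    have "joint_eigenvector {0 :: ('a^'n) \<times> ('a^'n)} 1"
      unfolding joint_eigenvector_def by (auto simp: vec_eq_iff intro!: exI[of _ 1])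
    then show "\<exists>\<psi>. joint_eigenvector {0 :: ('a^'n) \<times> ('a^'n)} \<psi>" by blast
  next
    fix U and v :: "('a^'n) \<times> ('a^'n)" 
    assume U: "add_subgroup U" "U \<subseteq> D" "v \<in> D" and "\<exists>\<psi>. joint_eigenvector U \<psi>"
    moreover have "tr_symp u v = 0" if "u \<in> U" for u using that U D symp_dualD by blast
    ultimately show "\<exists>\<psi>. joint_eigenvector (pairs.adjoin U v) \<psi>"
      using joint_eigenvector_adjoin by blast
  qed
qed

section \<open>Dimensions of joint eigenspaces and inclusions between them\<close>

lemma dim_eq_trace_of_projection:
  fixes Q :: "(complex^'m) set" and P :: "complex^'m \<Rightarrow> complex^'m"
  assumes P: "Vector_Spaces.linear (*s) (*s) P" and range: "\<And>x. P x \<in> Q" and fixed: "\<And>x. x \<in> Q \<Longrightarrow> P x = x"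
  shows "of_nat (vec.dim Q) = (\<Sum>y\<in>UNIV. P (axis y 1) $ y)"
proof -
  obtain B where B: "B \<subseteq> Q" "vec.independent B" "Q \<subseteq> vec.span B" "card B = vec.dim Q"
    by (rule vec.basis_exists)
  have fin: "finite B" using vec.finiteI_independent B by blast
  define f where "f b x = vec.representation B (P x) b" for b x
  have span: "P x \<in> vec.span B" for x using range B by blast
  have P_add: "P (x + y) = P x + P y" and P_scale: "P (c *s x) = c *s P x" for x y c
    using P by (auto simp: Vector_Spaces.linear_iff)
  have f_add: "f b (x + y) = f b x + f b y" and f_scale: "f b (c *s x) = c * f b x" for b x y c
    using B span by (simp_all add: f_def P_add P_scale vec.representation_add vec.representation_scale)
  have f_0: "f b 0 = 0" for b using f_scale[of b 0 0] by simp
  have f_sum: "f b (sum g A) = (\<Sum>y\<in>A. f b (g y))" for b g and A :: "'m set"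
    by (induction A rule: infinite_finite_induct) (auto simp: f_add f_0)
  have Px: "P x = (\<Sum>b\<in>B. f b x *s b)" for x
    unfolding f_def by (rule vec.sum_representation_eq[symmetric]) (use B span fin in auto)
  \<comment> \<open>Expanding in a basis of \<open>Q\<close> and exchanging the sums turns the trace
    into the sum over \<open>b\<close> of the coordinate of \<open>b\<close> along itself, which is
    1.\<close>
  have "(\<Sum>y\<in>UNIV. P (axis y 1) $ y) = (\<Sum>y\<in>UNIV. \<Sum>b\<in>B. f b (axis y 1) * b $ y)"
    by (subst Px) simp
  also have "\<dots> = (\<Sum>b\<in>B. \<Sum>y\<in>UNIV. b $ y * f b (axis y 1))"
    by (subst sum.swap) (simp add: mult.commute)
  also have "\<dots> = (\<Sum>b\<in>B. f b (\<Sum>y\<in>UNIV. b $ y *s axis y 1))"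
    by (simp add: f_sum f_scale)
  also have "\<dots> = (\<Sum>b\<in>B. f b b)" by (simp add: basis_expansion)
  also have "\<dots> = (\<Sum>b\<in>B. 1)"
    by (rule sum.cong) (use B fixed in \<open>auto simp: f_def vec.representation_basis\<close>)
  finally show ?thesis by (simp add: B)
qed

text \<open>Translating the summation variable by a suitable \<open>x\<close> multiplies the sum by
  a phase different from 1.\<close>

lemma sum_add_char:
  assumes "b \<noteq> 0"
  shows "(\<Sum>y\<in>UNIV. add_char (scalar_product b (y :: 'a::finite_field^'n))) = 0"
proof -
  obtain i where i: "b $ i \<noteq> 0" using assms by (auto simp: vec_eq_iff)
  obtain z :: 'a where z: "abs_trace z \<noteq> 0" using abs_trace_surj by blast
  define x :: "'a^'n" where "x = axis i (z / b $ i)"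
  have "scalar_product b x = (\<Sum>j\<in>UNIV. if j = i then z else 0)"
    unfolding scalar_product_def x_def by (rule sum.cong) (use i in \<open>auto simp: axis_def\<close>)
  then have x: "add_char (scalar_product b x) \<noteq> 1" using z by (simp add: add_char_eq_1_iff)
  let ?S = "\<Sum>y\<in>UNIV. add_char (scalar_product b y)"
  have "?S = (\<Sum>y\<in>UNIV. add_char (scalar_product b (y + x)))"
    by (rule sum.reindex_bij_witness[of _ "\<lambda>y. y + x" "\<lambda>y. y - x"]) auto
  also have "\<dots> = add_char (scalar_product b x) * ?S"
    by (simp add: scalar_product_add add_char_add sum_distrib_left mult.commute)
  finally have "(1 - add_char (scalar_product b x)) * ?S = 0" by (simp add: algebra_simps)
  then show ?thesis using x by simp
qed

text \<open>A proper shift has zero diagonal; without a shift the trace is a character sum.\<close>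

lemma trace_act:
  fixes v :: "('a::finite_field^'n) \<times> ('a^'n)"
  shows "(\<Sum>y\<in>UNIV. act v (axis y 1) $ y) = (if v = 0 then of_nat (CARD('a) ^ CARD('n)) else 0)"
proof (cases "fst v = 0")
  case True
  have "act v (axis y 1) $ y = add_char (scalar_product (snd v) y)" for y
    using True by (simp add: act_nth axis_def)
  then have eq: "(\<Sum>y\<in>UNIV. act v (axis y 1) $ y) = (\<Sum>y\<in>UNIV. add_char (scalar_product (snd v) y))"
    by simp
  show ?thesis
  proof (cases "snd v = 0")
    case snd: True
    then have "v = 0" using True by (simp add: prod_eq_iff)
    moreover have "scalar_product 0 y = 0" for y :: "'a^'n" by (simp add: scalar_product_def)
    ultimately show ?thesis unfolding eq by (simp add: CARD_vec)
  next
    case False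
    then have "v \<noteq> 0" by auto
    then show ?thesis unfolding eq using sum_add_char[OF False] by simp
  qed
next
  case False
  then have "act v (axis y 1) $ y = 0" for y by (simp add: act_nth axis_def)
  then show ?thesis using False by auto
qed

text \<open>Averaging the operators of \<open>D\<close>, each divided by its eigenvalue on a common
  eigenvector, projects onto the eigenspace. Only the zero element of \<open>D\<close> contributes
  to the trace of this projection.\<close>

lemma exists_joint_eigenspace:
  fixes D :: "(('a::finite_field^'n) \<times> ('a^'n)) set"
  assumes D: "add_subgroup D" "D \<subseteq> symp_dual D"
  obtains Q where "joint_eigenspace D Q" "vec.dim Q * card D = CARD('a) ^ CARD('n)"
proof -
  obtain \<psi> where \<psi>: "\<psi> \<noteq> 0" "\<And>v. v \<in> D \<Longrightarrow> \<exists>c. act v \<psi> = c *s \<psi>"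
    using exists_joint_eigenvector[OF D] unfolding joint_eigenvector_def by blast
  then obtain \<mu> where \<mu>: "act v \<psi> = \<mu> v *s \<psi>" if "v \<in> D" for v by metis
  have \<mu>_nz: "\<mu> v \<noteq> 0" if "v \<in> D" for v using \<mu>[OF that] act_nonzero[OF \<psi>(1), of v] by auto
  \<comment> \<open>The eigenvalues obey the same twisted product rule as the operators, so the
    operators divided by them multiply without phases and can be averaged.\<close>
  have \<mu>_add: "\<mu> v * \<mu> w = add_char (scalar_product (snd v) (fst w)) * \<mu> (v + w)"
    if "v \<in> D" "w \<in> D" for v w
  proof -
    have "(\<mu> w * \<mu> v) *s \<psi> = (add_char (scalar_product (snd v) (fst w)) * \<mu> (v + w)) *s \<psi>"
      using act_act[of v w \<psi>] \<mu> that add_subgroup_add[OF D(1) that] by (simp add: act_scale)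
    then show ?thesis using \<psi>(1) by (simp add: vec.scale_right_imp_eq mult.commute)
  qed
  define Q where "Q = {\<phi>. \<forall>v\<in>D. act v \<phi> = \<mu> v *s \<phi>}"
  have "\<psi> \<in> Q" using \<mu> by (simp add: Q_def)
  then have "joint_eigenspace D Q" using \<psi>(1) unfolding joint_eigenspace_def Q_def by blast
  define P where "P \<phi> = (1 / of_nat (card D)) *s (\<Sum>v\<in>D. (1 / \<mu> v) *s act v \<phi>)" for \<phi>
  have cD: "card D \<noteq> 0" using add_subgroup_0[OF D(1)] by auto
  have lin: "Vector_Spaces.linear (*s) (*s) P"
    unfolding Vector_Spaces.linear_iff P_def
    by (intro conjI allI) (auto simp: vec_eq_iff act_nth algebra_simps sum.distrib sum_distrib_left vec.vector_space_axioms)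
  have "P \<phi> \<in> Q" for \<phi>
    unfolding Q_def
  proof (intro CollectI ballI)
    fix w assume w: "w \<in> D"
    have "act w ((1 / \<mu> v) *s act v \<phi>) = \<mu> w *s ((1 / \<mu> (w + v)) *s act (w + v) \<phi>)" if v: "v \<in> D" for v
    proof -
      have "add_char (scalar_product (snd w) (fst v)) / \<mu> v = \<mu> w / \<mu> (w + v)"
        using \<mu>_add[OF w v] \<mu>_nz[OF v] \<mu>_nz[OF add_subgroup_add[OF D(1) w v]] by (simp add: field_simps)
      then show ?thesis by (simp add: act_scale act_act)
    qed
    then have "act w (P \<phi>) = (1 / of_nat (card D)) *s (\<Sum>v\<in>D. \<mu> w *s ((1 / \<mu> (w + v)) *s act (w + v) \<phi>))"
      by (simp add: P_def act_scale act_sum)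
    also have "(\<Sum>v\<in>D. \<mu> w *s ((1 / \<mu> (w + v)) *s act (w + v) \<phi>)) = (\<Sum>v\<in>D. \<mu> w *s ((1 / \<mu> v) *s act v \<phi>))"
      by (rule sum.reindex_bij_witness[of _ "\<lambda>v. v - w" "\<lambda>v. w + v"])
         (use add_subgroup_add[OF D(1) w] add_subgroup_diff[OF D(1) _ w] in simp_all)
    also have "(1 / of_nat (card D)) *s \<dots> = \<mu> w *s P \<phi>"
      unfolding P_def vec.scale_sum_right[symmetric] by (simp add: mult.commute)
    finally show "act w (P \<phi>) = \<mu> w *s P \<phi>" .
  qed
  moreover have "P \<phi> = \<phi>" if "\<phi> \<in> Q" for \<phi>
  proof -
    have "(1 / \<mu> v) *s act v \<phi> = \<phi>" if "v \<in> D" for v using that \<open>\<phi> \<in> Q\<close> \<mu>_nz[OF that] by (simp add: Q_def)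
    then have "P \<phi> = (1 / of_nat (card D)) *s (\<Sum>v\<in>D. \<phi>)" unfolding P_def by simp
    moreover have "(\<Sum>v\<in>D. \<phi>) $ y = of_nat (card D) * \<phi> $ y" for y
      by (subst sum_component) simp
    ultimately show ?thesis using cD by (simp add: vec_eq_iff del: sum_constant)
  qed
  ultimately have "of_nat (vec.dim Q) = (\<Sum>y\<in>UNIV. P (axis y 1) $ y)"
    by (rule dim_eq_trace_of_projection[OF lin])
  also have "\<dots> = (1 / of_nat (card D)) * (\<Sum>v\<in>D. (1 / \<mu> v) * (\<Sum>y\<in>UNIV. act v (axis y 1) $ y))"
    unfolding P_def by (simp add: sum_distrib_left sum_divide_distrib sum.swap[of _ D])
  also have "(\<Sum>v\<in>D. (1 / \<mu> v) * (\<Sum>y\<in>UNIV. act v (axis y 1) $ y))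
      = (\<Sum>v\<in>D. if v = 0 then of_nat (CARD('a) ^ CARD('n)) / \<mu> 0 else 0)"
    by (rule sum.cong) (auto simp: trace_act)
  also have "\<dots> = of_nat (CARD('a) ^ CARD('n))"
  proof -
    have "\<mu> 0 = 1" using \<mu>[OF add_subgroup_0[OF D(1)]] \<psi>(1) vec.scale_right_imp_eq[of \<psi> "\<mu> 0" 1] by simp
    then show ?thesis using add_subgroup_0[OF D(1)] by simp
  qed
  finally have "(of_nat (vec.dim Q) :: complex) * of_nat (card D) = of_nat (CARD('a) ^ CARD('n))"
    using cD by simp
  then have "vec.dim Q * card D = CARD('a) ^ CARD('n)"
    unfolding of_nat_mult[symmetric] of_nat_eq_iff .
  with \<open>joint_eigenspace D Q\<close> show ?thesis by (rule that)
qed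

lemma subset_of_joint_eigenspaces:
  fixes D1 D2 :: "(('a::finite_field^'n) \<times> ('a^'n)) set"
  assumes D2: "add_subgroup D2" "D2 \<subseteq> symp_dual D2"
    and Q: "joint_eigenspace D1 Q1" "joint_eigenspace D2 Q2" "Q2 \<subseteq> Q1"
  shows "D1 \<subseteq> D2"
proof
  fix v assume v: "v \<in> D1"
  obtain \<mu>1 where \<mu>1: "Q1 = {\<psi>. \<forall>v\<in>D1. act v \<psi> = \<mu>1 v *s \<psi>}" using Q(1) unfolding joint_eigenspace_def by blast
  obtain \<mu>2 where \<mu>2: "Q2 = {\<psi>. \<forall>v\<in>D2. act v \<psi> = \<mu>2 v *s \<psi>}" using Q(2) unfolding joint_eigenspace_def by blast
  have "0 \<in> Q2" using act_scale[of _ 0 0] by (simp add: \<mu>2)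
  then obtain \<psi> where \<psi>: "\<psi> \<in> Q2" "\<psi> \<noteq> 0" using Q(2) unfolding joint_eigenspace_def by blast
  have v_act: "act v \<phi> = \<mu>1 v *s \<phi>" if "\<phi> \<in> Q2" for \<phi> using that Q(3) v \<mu>1 by blast
  have "v \<in> symp_dual (symp_dual D2)"
  proof (rule symp_dualI)
    fix w assume w: "w \<in> symp_dual D2"
    have "act w \<psi> \<in> Q2"
      unfolding \<mu>2
    proof (intro CollectI ballI)
      fix u assume u: "u \<in> D2"
      have "act u (act w \<psi>) = act w (act u \<psi>)" using symp_dualD[OF w u] by (simp add: act_commute_orth)
      then show "act u (act w \<psi>) = \<mu>2 u *s act w \<psi>" using \<psi>(1) u by (simp add: \<mu>2 act_scale)
    qed
    \<comment> \<open>Both vectors lie in \<open>Q2\<close>, where \<open>v\<close> acts as one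
      scalar. The commutation phase can be read off from a single nonzero vector and is therefore
      1.\<close>
    then have "act v (act w \<psi>) = act w (act v \<psi>)" using \<psi>(1) by (simp add: v_act act_scale)
    moreover obtain c where "act v (act w \<psi>) = c *s act w (act v \<psi>)" and c: "c = 1 \<longleftrightarrow> tr_symp v w = 0"
      using act_commute[of v w \<psi>] by blast
    ultimately have "c *s act w (act v \<psi>) = 1 *s act w (act v \<psi>)" by simp
    then have "c = 1" using act_nonzero[OF act_nonzero[OF \<psi>(2)]] vec.scale_right_imp_eq by blast
    then show "tr_symp v w = 0" using c by simp
  qed
  then show "v \<in> D2" using symp_dual_symp_dual[OF D2(1)] by simp
qed


section \<open>Direct sums of codes\<close>

text \<open>The doubled length is given by an arbitrary index type of the right size;
  \<open>l\<close> and \<open>r\<close> present it as two disjoint copies of the original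
  one.\<close>

locale halves =
  fixes l r :: "'n::finite \<Rightarrow> 'm::finite"
  assumes inj_l: "inj l" and inj_r: "inj r"
    and disjoint: "range l \<inter> range r = {}" and cover: "range l \<union> range r = UNIV"
begin

definition left :: "('a::finite_field^'m) \<times> ('a^'m) \<Rightarrow> ('a^'n) \<times> ('a^'n)" where
  "left v = of_sites (\<lambda>i. site v (l i))"

definition right :: "('a::finite_field^'m) \<times> ('a^'m) \<Rightarrow> ('a^'n) \<times> ('a^'n)" where
  "right v = of_sites (\<lambda>i. site v (r i))"

definition join :: "('a::finite_field^'n) \<times> ('a^'n) \<Rightarrow> ('a^'n) \<times> ('a^'n) \<Rightarrow> ('a^'m) \<times> ('a^'m)" where
  "join v w = of_sites (\<lambda>j. if j \<in> range l then site v (inv l j) else site w (inv r j))"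

definition direct_sum ::
    "(('a::finite_field^'n) \<times> ('a^'n)) set \<Rightarrow> (('a^'n) \<times> ('a^'n)) set \<Rightarrow> (('a^'m) \<times> ('a^'m)) set" where
  "direct_sum C1 C2 = {v. left v \<in> C1 \<and> right v \<in> C2}"

lemma left_join [simp]: "left (join v w) = v"
  by (rule site_eqI) (simp add: left_def join_def inj_l)

lemma right_join [simp]: "right (join v w) = w"
proof (rule site_eqI)
  fix i
  have "r i \<notin> range l" using disjoint by blast
  then show "site (right (join v w)) i = site w i" by (simp add: right_def join_def inj_r)
qed

lemma halves_eqI: "left v = left w \<Longrightarrow> right v = right w \<Longrightarrow> v = w"
proof (rule site_eqI)
  fix j assume "left v = left w" "right v = right w"
  then have "site (left v) i = site (left w) i \<and> site (right v) i = site (right w) i" for i by simp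
  then have "site v (l i) = site w (l i)" "site v (r i) = site w (r i)" for i
    by (simp_all add: left_def right_def)
  moreover have "j \<in> range l \<or> j \<in> range r" using cover by blast
  ultimately show "site v j = site w j" by blast
qed

lemma left_linear [simp]: "left 0 = 0" "left (v + w) = left v + left w" "left (v - w) = left v - left w"
  by (rule site_eqI; simp add: left_def)+

lemma right_linear [simp]: "right 0 = 0" "right (v + w) = right v + right w" "right (v - w) = right v - right w"
  by (rule site_eqI; simp add: right_def)+

lemma sum_halves: "(\<Sum>j\<in>UNIV. f j) = (\<Sum>i\<in>UNIV. f (l i)) + (\<Sum>i\<in>UNIV. f (r i) :: 'z::comm_monoid_add)"
proof -
  have "(\<Sum>j\<in>UNIV. f j) = (\<Sum>j\<in>range l. f j) + (\<Sum>j\<in>range r. f j)"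
    by (subst cover[symmetric], rule sum.union_disjoint) (auto simp: disjoint)
  then show ?thesis by (simp add: sum.reindex inj_l inj_r)
qed

lemma swt_halves: "swt v = swt (left v) + swt (right v)"
proof -
  have card_sum: "card {j. P j} = (\<Sum>j\<in>UNIV. if P j then 1 else 0)" for P :: "'z::finite \<Rightarrow> bool"
    by (simp add: sum.If_cases)
  show ?thesis
    unfolding swt_site card_sum sum_halves by (simp add: left_def right_def)
qed

lemma tr_symp_halves: "tr_symp v w = tr_symp (left v) (left w) + tr_symp (right v) (right w)"
  unfolding tr_symp_site sum_halves by (simp add: left_def right_def)

lemma direct_sum_eq: "direct_sum C1 C2 = (\<lambda>(v, w). join v w) ` (C1 \<times> C2)"
proof
  show "direct_sum C1 C2 \<subseteq> (\<lambda>(v, w). join v w) ` (C1 \<times> C2)"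
  proof
    fix v assume v: "v \<in> direct_sum C1 C2"
    have "v = join (left v) (right v)" by (rule halves_eqI) simp_all
    moreover have "(left v, right v) \<in> C1 \<times> C2" using v by (simp add: direct_sum_def)
    ultimately show "v \<in> (\<lambda>(v, w). join v w) ` (C1 \<times> C2)"
      using image_eqI[of v "\<lambda>(v, w). join v w" "(left v, right v)"] by simp
  qed
  show "(\<lambda>(v, w). join v w) ` (C1 \<times> C2) \<subseteq> direct_sum C1 C2"
    by (auto simp: direct_sum_def)
qed

lemma card_direct_sum: "card (direct_sum C1 C2) = card C1 * card C2"
proof -
  have "inj_on (\<lambda>(v, w). join v w) (C1 \<times> C2)"
    by (rule inj_on_inverseI[of _ "\<lambda>v. (left v, right v)"]) (simp add: case_prod_beta)
  then show ?thesis by (simp add: direct_sum_eq card_image card_cartesian_product)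
qed

lemma subgroup_direct_sum: "add_subgroup C1 \<Longrightarrow> add_subgroup C2 \<Longrightarrow> add_subgroup (direct_sum C1 C2)"
  by (simp add: add_subgroup_def direct_sum_def)

lemma symp_dual_direct_sum:
  assumes "add_subgroup C1" "add_subgroup C2"
  shows "symp_dual (direct_sum C1 C2) = direct_sum (symp_dual C1) (symp_dual C2)"
proof
  show "symp_dual (direct_sum C1 C2) \<subseteq> direct_sum (symp_dual C1) (symp_dual C2)"
  proof
    fix v assume v: "v \<in> symp_dual (direct_sum C1 C2)"
    have "tr_symp (left v) c = 0" if "c \<in> C1" for c
      using symp_dualD[OF v, of "join c 0"] that add_subgroup_0[OF assms(2)]
      by (simp add: direct_sum_def tr_symp_halves)
    moreover have "tr_symp (right v) c = 0" if "c \<in> C2" for c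
      using symp_dualD[OF v, of "join 0 c"] that add_subgroup_0[OF assms(1)]
      by (simp add: direct_sum_def tr_symp_halves)
    ultimately show "v \<in> direct_sum (symp_dual C1) (symp_dual C2)"
      by (simp add: direct_sum_def mem_symp_dual)
  qed
  show "direct_sum (symp_dual C1) (symp_dual C2) \<subseteq> symp_dual (direct_sum C1 C2)"
    by (intro subsetI symp_dualI) (simp add: direct_sum_def mem_symp_dual tr_symp_halves)
qed

end

lemma exists_halves:
  assumes "CARD('m::finite) = 2 * CARD('n::finite)"
  obtains l r :: "'n::finite \<Rightarrow> 'm::finite" where "halves l r"
proof -
  have "CARD('n + 'n) = CARD('m)" using assms by simp
  then obtain \<phi> :: "'n + 'n \<Rightarrow> 'm" where \<phi>: "bij \<phi>"
    using finite_same_card_bij[of "UNIV :: ('n + 'n) set" "UNIV :: 'm set"] by auto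
  have U: "(UNIV :: ('n + 'n) set) = range Inl \<union> range Inr" by (rule UNIV_sum)
  have "range (\<lambda>i. \<phi> (Inl i)) \<union> range (\<lambda>i. \<phi> (Inr i)) = range \<phi>"
    unfolding U by (simp add: image_Un image_image)
  then have "range (\<lambda>i. \<phi> (Inl i)) \<union> range (\<lambda>i. \<phi> (Inr i)) = UNIV" using \<phi> by (simp add: bij_is_surj)
  moreover have "inj \<phi>" using \<phi> by (rule bij_is_inj)
  ultimately have "halves (\<lambda>i. \<phi> (Inl i)) (\<lambda>i. \<phi> (Inr i))"
    by unfold_locales (auto simp: inj_def)
  then show ?thesis by (rule that)
qed


section \<open>Pure codes from isotropic subgroups\<close>

text \<open>Here \<open>p^m\<close> stands for the dimension \<open>K R\<close>; squaring the
  hypothesis gives the order \<open>q^(2n)\<close> of the whole space.\<close>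

lemma card_symp_dual_of_isotropic:
  fixes D :: "(('a::finite_field^'n) \<times> ('a^'n)) set"
  assumes D: "add_subgroup D" and card: "card D * CHAR('a) ^ m = CARD('a) ^ CARD('n)"
  shows "card (symp_dual D) = CHAR('a) ^ (2 * m) * card D"
proof -
  have "card D * card (symp_dual D) = (card D * CHAR('a) ^ m) * (card D * CHAR('a) ^ m)"
    unfolding card using card_symp_dual[OF D] by (simp add: mult_2 power_add)
  also have "\<dots> = card D * (CHAR('a) ^ (2 * m) * card D)" by (simp add: mult_2 power_add)
  finally show ?thesis using add_subgroup_0[OF D] by auto
qed

lemma Min_swt_eq:
  assumes "e \<in> S" "e \<noteq> 0" "\<And>v. v \<in> S \<Longrightarrow> v \<noteq> 0 \<Longrightarrow> swt e \<le> swt v"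
  shows "min_swt S = swt e"
  unfolding min_swt_def
proof (rule Min_eqI)
  show "swt e \<in> swt ` (S - {0})" using assms(1,2) by blast
  show "swt e \<le> w" if "w \<in> swt ` (S - {0})" for w using that assms(3) by blast
qed simp

text \<open>For \<open>j < m\<close> the group \<open>C\<close> is the dual of a tower of
  \<open>m - j\<close> hyperbolic planes over \<open>D\<close>, the first of them through
  \<open>e\<close>, so \<open>e\<close> stays outside of \<open>C\<close> and attains the distance.
  Purity is automatic because \<open>C\<close> lies in the dual of \<open>D\<close>.\<close>

lemma pure_code_of_minimum_word:
  fixes D :: "(('a::finite_field^'n) \<times> ('a^'n)) set"
  assumes D: "add_subgroup D" "D \<subseteq> symp_dual D" and card: "card D * CHAR('a) ^ m = CARD('a) ^ CARD('n)"
    and e: "e \<in> symp_dual D" "e \<noteq> 0" and j: "j \<le> m" "j = m \<or> e \<notin> D"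
    and min: "\<And>v. v \<in> symp_dual D \<Longrightarrow> v \<noteq> 0 \<Longrightarrow> swt e \<le> swt v"
  shows "\<exists>(Q :: (complex^('a^'n)) set) C.
    subsystem_code Q C (CHAR('a) ^ (m - j)) (CHAR('a) ^ j) (swt e) \<and> pure_to C (swt e)"
proof -
  note dual = card_symp_dual_of_isotropic[OF D(1) card]
  obtain C where C: "add_subgroup C" "symp_radical C = D" "card C = CHAR('a) ^ (2 * j) * card D" 
    "C \<subseteq> symp_dual D" "(if symp_dual D \<noteq> C then min_swt (symp_dual D - C) else min_swt (symp_dual D)) = swt e"
  proof (cases "j = m")
    \<comment> \<open>This is \<open>K = 1\<close>: the group \<open>C\<close> is the whole dual,
      and the distance is the minimum weight of the dual itself.\<close>
    case True
    have "symp_dual (symp_dual D) = D" by (rule symp_dual_symp_dual[OF D(1)])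
    then have "symp_radical (symp_dual D) = D" using D(2) by (auto simp: symp_radical_def)
    moreover have "min_swt (symp_dual D) = swt e" by (rule Min_swt_eq[OF e min])
    ultimately show ?thesis using that[of "symp_dual D"] subgroup_symp_dual[of D] dual True by simp
  next
    case False
    then have eD: "e \<notin> D" "1 \<le> m - j" using j by auto
    obtain G where G: "add_subgroup G" "e \<in> G" "symp_radical G = D" "card G = CHAR('a) ^ (2 * (m - j)) * card D"
      using hyperbolic_tower[OF D e(1) eD(1) dual eD(2)] by auto
    have "card (symp_dual G) = CHAR('a) ^ (2 * j) * card D"
      using card_symp_dual_isotropic[OF D(1) dual G(1,4)] j by simp
    moreover have "e \<notin> symp_dual G" using G(2,3) eD by (auto simp: symp_radical_def)
    then have "min_swt (symp_dual D - symp_dual G) = swt e" "symp_dual D \<noteq> symp_dual G"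
      using e min by (auto intro!: Min_swt_eq)
    moreover have "symp_dual G \<subseteq> symp_dual D"
      by (rule symp_dual_antimono) (use G(3) in \<open>auto simp: symp_radical_def\<close>)
    ultimately show ?thesis
      using that[of "symp_dual G"] subgroup_symp_dual[of G] symp_radical_symp_dual[OF G(1)] G(3) by simp
  qed
  obtain Q where Q: "joint_eigenspace D Q" "vec.dim Q * card D = CARD('a) ^ CARD('n)"
    by (rule exists_joint_eigenspace[OF D])
  have p: "1 \<le> CHAR('a) ^ k" for k by (simp add: Suc_le_eq)
  have KR: "CHAR('a) ^ (m - j) * CHAR('a) ^ j = CHAR('a) ^ m" using j by (simp flip: power_add)
  have "vec.dim Q * card D = CHAR('a) ^ m * card D" using Q(2) card by (simp add: mult.commute)
  then have dimQ: "vec.dim Q = CHAR('a) ^ (m - j) * CHAR('a) ^ j"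
    unfolding KR using add_subgroup_0[OF D(1)] by auto
  have q: "real CARD('a) ^ CARD('n) = real (card D) * (real (CHAR('a) ^ (m - j)) * real (CHAR('a) ^ j))"
    using card KR by (metis of_nat_mult of_nat_power)
  have "subsystem_code Q C (CHAR('a) ^ (m - j)) (CHAR('a) ^ j) (swt e)"
    unfolding subsystem_code_def Let_def symp_radical_def[symmetric] C(2)
    using C Q dimQ p[of j] p[of "m - j"] q by (simp add: field_simps power_mult power2_eq_square mult_2 power_add)
  moreover have "pure_to C (swt e)" using C(4) min by (auto simp: pure_to_def not_less)
  ultimately show ?thesis by blast
qed

lemma (in halves) pure_code_of_direct_sum:
  fixes D1 D2 :: "(('a::finite_field^'n) \<times> ('a^'n)) set"
  assumes D1: "add_subgroup D1" "D1 \<subseteq> symp_dual D1" and D2: "add_subgroup D2" "D2 \<subseteq> symp_dual D2"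
    and e1: "e1 \<in> symp_dual D1" "e1 \<noteq> 0"
    and min1: "\<And>v. v \<in> symp_dual D1 \<Longrightarrow> v \<noteq> 0 \<Longrightarrow> swt e1 \<le> swt v"
    and min2: "\<And>v. v \<in> symp_dual D2 \<Longrightarrow> v \<noteq> 0 \<Longrightarrow> swt e1 \<le> swt v"
    and card: "card D1 * card D2 * CHAR('a) ^ m = CARD('a) ^ CARD('m)" and j: "j \<le> m"
  shows "\<exists>(Q :: (complex^('a^'m)) set) C.
    subsystem_code Q C (CHAR('a) ^ (m - j)) (CHAR('a) ^ j) (swt e1) \<and> pure_to C (swt e1)"
proof -
  define D where "D = direct_sum D1 D2"
  define \<delta> where "\<delta> = swt e1"
  have D: "add_subgroup D" unfolding D_def by (rule subgroup_direct_sum[OF D1(1) D2(1)])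
  have E: "symp_dual D = direct_sum (symp_dual D1) (symp_dual D2)"
    unfolding D_def by (rule symp_dual_direct_sum[OF D1(1) D2(1)])
  have iso: "D \<subseteq> symp_dual D" unfolding E unfolding D_def direct_sum_def using D1(2) D2(2) by blast
  have cardD: "card D * CHAR('a) ^ m = CARD('a) ^ CARD('m)"
    unfolding D_def card_direct_sum by (rule card)
  have min: "\<delta> \<le> swt v" if v: "v \<in> symp_dual D" "v \<noteq> 0" for v
  proof -
    have "left v \<noteq> 0 \<or> right v \<noteq> 0" using v(2) halves_eqI[of v 0] by auto
    then show ?thesis
      using min1[of "left v"] min2[of "right v"] v(1)
      by (auto simp: E direct_sum_def swt_halves[of v] \<delta>_def)
  qed
  define e where "e = join e1 0"
  have e: "e \<in> symp_dual D" "swt e = \<delta>"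
    using e1 add_subgroup_0[OF subgroup_symp_dual]
    by (simp_all add: e_def E direct_sum_def swt_halves \<delta>_def swt_eq_0_iff)
  have \<delta>_pos: "\<delta> > 0" using e1 by (simp add: \<delta>_def swt_eq_0_iff zero_less_iff_neq_zero)
  \<comment> \<open>The first two cases keep \<open>D\<close>. In the third no word of minimum
    weight can stay outside of \<open>C\<close> as long as \<open>D\<close> is kept, so
    \<open>D\<close> is exchanged.\<close>
  consider "j = m" | f where "j < m" "f \<in> symp_dual D" "f \<notin> D" "swt f = \<delta>"
    | "j < m" "\<forall>v\<in>symp_dual D. swt v = \<delta> \<longrightarrow> v \<in> D" using j by fastforce
  then show ?thesis
  proof cases
    case 1
    have "e \<noteq> 0" using e(2) \<delta>_pos swt_eq_0_iff[of e] by simp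
    then show ?thesis
      using pure_code_of_minimum_word[OF D iso cardD e(1) _ j] 1 e(2) min unfolding \<delta>_def by auto
  next
    case 2
    have "f \<noteq> 0" using 2(4) \<delta>_pos swt_eq_0_iff[of f] by simp
    then show ?thesis
      using pure_code_of_minimum_word[OF D iso cardD 2(2) _ j] 2 min unfolding \<delta>_def by auto
  next
    case 3
    have eD: "e \<in> D" using 3(2) e by blast
    then have e1D: "e1 \<in> D1" by (simp add: D_def direct_sum_def e_def)
    have min_D1: "v \<in> D1" if "v \<in> symp_dual D1" "swt v = \<delta>" for v
    proof -
      have "join v 0 \<in> symp_dual D" "swt (join v 0) = \<delta>"
        using that add_subgroup_0[OF subgroup_symp_dual]
        by (simp_all add: E direct_sum_def swt_halves swt_eq_0_iff)
      then have "join v 0 \<in> D" using 3(2) by blast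
      then show ?thesis by (simp add: D_def direct_sum_def)
    qed
    \<comment> \<open>The upper half of \<open>\<delta>\<close> is the delicate one: for odd
      \<open>\<delta>\<close> the triangle inequality alone falls short by one.\<close>
    obtain t1 where t1: "tr_symp t1 e1 \<noteq> 0" "\<And>u. u \<in> symp_dual D1 \<Longrightarrow> (\<delta> + 1) div 2 \<le> swt (t1 + u)"
      by (rule exists_coset_leader[of D1 \<delta> e1 "(\<delta> + 1) div 2"])
         (use D1 min1 min_D1 e1D \<delta>_pos in \<open>auto simp: \<delta>_def\<close>)
    obtain W where W: "W \<subseteq> support e1" "card W = \<delta> div 2"
      by (rule obtain_subset_with_card_n[of "\<delta> div 2" "support e1"]) (auto simp: \<delta>_def swt_site)
    \<comment> \<open>For the lower half any word of this weight will do, by the triangle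
      inequality; a truncation of \<open>e1\<close> provides one.\<close>
    define t2 where "t2 = of_sites (\<lambda>i. if i \<in> W then site e1 i else 0)"
    have "support t2 = W" using W(1) by (auto simp: t2_def)
    then have t2w: "swt t2 = \<delta> div 2" using W(2) by (simp add: swt_site)
    have t2: "\<delta> div 2 \<le> swt (t2 + u)" if u: "u \<in> symp_dual D2" for u
    proof (cases "u = 0")
      case False
      then have "\<delta> \<le> swt u" using min2 u by (simp add: \<delta>_def)
      also have "swt u \<le> swt (t2 + u) + swt t2" using swt_diff_le[of "t2 + u" t2] by simp
      finally show ?thesis using t2w by linarith
    qed (simp add: t2w)
    define t where "t = join t1 t2"
    have tu: "\<delta> \<le> swt (t + u)" if "u \<in> symp_dual D" for u
    proof -
      have "left (t + u) = t1 + left u" "right (t + u) = t2 + right u" by (simp_all add: t_def)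
      moreover have "left u \<in> symp_dual D1" "right u \<in> symp_dual D2"
        using that by (simp_all add: E direct_sum_def)
      ultimately show ?thesis
        using t1(2)[of "left u"] t2[of "right u"] swt_halves[of "t + u"] by simp
    qed
    have te: "tr_symp e t \<noteq> 0"
      using t1(1) tr_symp_eq_0_commute[of e1] by (simp add: tr_symp_halves e_def t_def)
    \<comment> \<open>The dual of \<open>D'\<close> is the dual of \<open>D\<close> with
      \<open>t\<close> adjoined, and \<open>e\<close> has left the group since it is not orthogonal
      to \<open>t\<close>.\<close>
    define D' where "D' = {x \<in> D. tr_symp x t = 0}"
    have "symp_dual (pairs.adjoin (symp_dual D) t) = D'"
      unfolding D'_def symp_dual_adjoin[OF subgroup_symp_dual] symp_dual_symp_dual[OF D] ..
    then have E': "symp_dual D' = pairs.adjoin (symp_dual D) t" and D': "add_subgroup D'"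
      using symp_dual_symp_dual[OF pairs.subgroup_adjoin[OF subgroup_symp_dual]] subgroup_symp_dual by blast+
    have iso': "D' \<subseteq> symp_dual D'"
      unfolding E' using iso pairs.subset_adjoin[of "symp_dual D" t] by (auto simp: D'_def)
    have min': "\<delta> \<le> swt v" if v: "v \<in> symp_dual D'" "v \<noteq> 0" for v
    proof -
      obtain u c where u: "u \<in> symp_dual D" "c \<in> prime_field" "v = u + scale_pair c t"
        using v(1) unfolding E' by (rule pairs.adjoinE)
      show ?thesis
      proof (cases "c = 0")
        case True
        then show ?thesis using min[OF u(1)] u(3) v(2) by (simp flip: zero_prod_def)
      next
        case False
        \<comment> \<open>Dividing by \<open>c\<close> preserves the weight and leads back to the
          coset of \<open>t\<close> itself.\<close>
        let ?c = "1 / c"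
        have "?c \<in> prime_field" using u(2) by (intro prime_field_divide prime_field_1)
        then have cu: "scale_pair ?c u \<in> symp_dual D"
          by (rule pairs.subgroup_scale[OF subgroup_symp_dual u(1)])
        have "scale_pair ?c v = t + scale_pair ?c u"
          using False by (simp add: u(3) prod_eq_iff vector_add_ldistrib vector_smult_assoc)
        then show ?thesis using tu[OF cu] swt_scale[of ?c v] False by simp
      qed
    qed
    have cardD': "CHAR('a) * card D' = card D"
      unfolding D'_def by (rule card_inter_perp[OF D eD te])
    then have cD': "card D' * CHAR('a) ^ Suc m = CARD('a) ^ CARD('m)"
      using cardD unfolding cardD'[symmetric] by (simp add: ac_simps)
    have "e \<in> symp_dual D'" unfolding E' using pairs.subset_adjoin[of "symp_dual D" t] e by blast
    moreover have "e \<notin> D'" using te by (simp add: D'_def)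
    moreover have "1 \<le> m" using 3 by simp
    \<comment> \<open>\<open>D'\<close> is smaller than \<open>D\<close> by the factor
      \<open>p\<close>, whence the exponent \<open>Suc m\<close>; the enlargement restores the order
      of \<open>D\<close>. Its dual lies in that of \<open>D'\<close> and still contains
      \<open>e\<close>, so the minimum weight remains \<open>\<delta>\<close>.\<close>
    ultimately obtain D'' where D'': "add_subgroup D''" "D' \<subseteq> D''" "D'' \<subseteq> symp_dual D''"
      "e \<in> symp_dual D''" "e \<notin> D''" "card D'' = CHAR('a) * card D'"
      using enlarge_isotropic[OF D' iso' _ _ card_symp_dual_of_isotropic[OF D' cD']] by metis
    have "e \<noteq> 0" using D''(5) add_subgroup_0[OF D''(1)] by auto
    moreover have "card D'' * CHAR('a) ^ m = CARD('a) ^ CARD('m)" using D''(6) cardD' cardD by simp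
    moreover have "swt e \<le> swt v" if "v \<in> symp_dual D''" "v \<noteq> 0" for v
      using min'[OF _ that(2)] symp_dual_antimono[OF D''(2)] that(1) e(2) by blast
    ultimately show ?thesis
      using pure_code_of_minimum_word[OF D''(1,3) _ D''(4) _ j] D''(5) e(2) unfolding \<delta>_def by auto
  qed
qed

text \<open>Purity bounds the weights inside \<open>C\<close> and the distance those outside, so
  \<open>d\<close> is the minimum weight of the whole dual of the radical.\<close>

lemma pure_code_minimum_word:
  fixes C :: "(('a::finite_field^'n) \<times> ('a^'n)) set"
  assumes code: "subsystem_code Q C K R d" and pure: "pure_to C d"
  shows "\<exists>e\<in>symp_dual (symp_radical C) - {0}. swt e = d \<and> (\<forall>v\<in>symp_dual (symp_radical C). v \<noteq> 0 \<longrightarrow> d \<le> swt v)"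
proof -
  let ?E = "symp_dual (symp_radical C)"
  have C: "add_subgroup C" and d: "d = (if ?E \<noteq> C then min_swt (?E - C) else min_swt ?E)"
    using code by (simp_all add: subsystem_code_def Let_def symp_radical_def)
  have sub: "C \<subseteq> ?E"
    using tr_symp_eq_0_commute symp_dualD unfolding symp_radical_def by (blast intro: symp_dualI)
  have R: "add_subgroup (symp_radical C)" by (rule subgroup_symp_radical[OF C])
  show ?thesis
  proof (cases "?E = C")
    case True
    \<comment> \<open>The minimum is taken over a nonempty set: \<open>?E\<close> contains the
      radical, and the product of their orders is \<open>q^(2n) > 1\<close>.\<close>
    have "\<not> ?E \<subseteq> {0}"
    proof
      assume "?E \<subseteq> {0}"
      then have "card ?E \<le> 1" "card (symp_radical C) \<le> 1"
        using symp_radical_isotropic[of C] card_mono[of "{0}" ?E] card_mono[of "{0}" "symp_radical C"] by auto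
      then have "card (symp_radical C) * card ?E \<le> 1" 
        using mult_le_mono[of "card (symp_radical C)" 1 "card ?E" 1] by simp
      moreover have "1 < CARD('a) ^ (2 * CARD('n))"
        unfolding CARD_prime_degree using CHAR_gt_1[where 'a='a] prime_degree_pos[where 'a='a]
        by (intro one_less_power) simp_all
      ultimately show False using card_symp_dual[OF R] by simp
    qed
    then have "swt ` (?E - {0}) \<noteq> {}" by blast
    moreover have "d = Min (swt ` (?E - {0}))" using d True by (simp add: min_swt_def)
    ultimately have "d \<in> swt ` (?E - {0})" "\<forall>v\<in>?E - {0}. d \<le> swt v" by simp_all
    then show ?thesis by blast
  next
    case False
    have "0 \<in> C" by (rule add_subgroup_0[OF C])
    then have "?E - C - {0} = ?E - C" by blast
    then have "d = Min (swt ` (?E - C))" using d False by (simp add: min_swt_def)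
    moreover have "swt ` (?E - C) \<noteq> {}" using sub False by blast
    ultimately have "d \<in> swt ` (?E - C)" "\<forall>v\<in>?E - C. d \<le> swt v" by simp_all
    moreover have "\<forall>v\<in>C. v \<noteq> 0 \<longrightarrow> d \<le> swt v" using pure by (simp add: pure_to_def not_less)
    ultimately show ?thesis using \<open>0 \<in> C\<close> by blast
  qed
qed

section \<open>Matching the parameters of the two codes with those of their direct sum\<close>

theorem theorem28:
  fixes Q\<^sub>1 Q\<^sub>2 :: "(complex^('a::finite_field^'n)) set"
    and C\<^sub>1 C\<^sub>2 :: "(('a^'n) \<times> ('a^'n)) set"
    and k\<^sub>1 k\<^sub>2 r\<^sub>1 r\<^sub>2 :: real
    and d\<^sub>1 d\<^sub>2 :: nat
  assumes "pure_subsystem_code Q\<^sub>1 C\<^sub>1 k\<^sub>1 r\<^sub>1 d\<^sub>1"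
    and "pure_subsystem_code Q\<^sub>2 C\<^sub>2 k\<^sub>2 r\<^sub>2 d\<^sub>2"
    and "Q\<^sub>2 \<subseteq> Q\<^sub>1"
    and "CARD('m::finite) = 2 * CARD('n)"
  shows "\<forall>r::real. 0 \<le> r \<and> r \<le> k\<^sub>1 + k\<^sub>2 + r\<^sub>1 + r\<^sub>2 \<and>
           real CARD('a) powr r \<in> \<nat> \<and>
           real CARD('a) powr (k\<^sub>1 + k\<^sub>2 + r\<^sub>1 + r\<^sub>2 - r) \<in> \<nat> \<longrightarrow>
         (\<exists>(Q :: (complex^('a^'m)) set) C d.
            pure_subsystem_code Q C (k\<^sub>1 + k\<^sub>2 + r\<^sub>1 + r\<^sub>2 - r) r d \<and> d \<ge> min d\<^sub>1 (2 * d\<^sub>2))"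
proof (intro allI impI)
  fix r :: real
  let ?q = "real CARD('a)" and ?s = "k\<^sub>1 + k\<^sub>2 + r\<^sub>1 + r\<^sub>2" and ?p = "CHAR('a)"
  assume r: "0 \<le> r \<and> r \<le> ?s \<and> ?q powr r \<in> \<nat> \<and> ?q powr (?s - r) \<in> \<nat>"
  then obtain K R where K: "real K = ?q powr (?s - r)" and R: "real R = ?q powr r"
    by (metis Nats_cases)
  obtain K1 R1 where code1: "real K1 = ?q powr k\<^sub>1" "real R1 = ?q powr r\<^sub>1"
    "subsystem_code Q\<^sub>1 C\<^sub>1 K1 R1 d\<^sub>1" "pure_to C\<^sub>1 d\<^sub>1"
    using assms(1) by (auto simp: pure_subsystem_code_def subsystem_code_log_def)
  obtain K2 R2 where code2: "real K2 = ?q powr k\<^sub>2" "real R2 = ?q powr r\<^sub>2"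
    "subsystem_code Q\<^sub>2 C\<^sub>2 K2 R2 d\<^sub>2" "pure_to C\<^sub>2 d\<^sub>2"
    using assms(2) by (auto simp: pure_subsystem_code_def subsystem_code_log_def)
  define D1 D2 where "D1 = symp_radical C\<^sub>1" and "D2 = symp_radical C\<^sub>2"
  have D1: "add_subgroup D1" "D1 \<subseteq> symp_dual D1" "joint_eigenspace D1 Q\<^sub>1"
    "real (card D1) = ?q ^ CARD('n) / (real K1 * real R1)" "K1 \<ge> 1" "R1 \<ge> 1"
    using code1(3) subgroup_symp_radical symp_radical_isotropic
    by (auto simp: subsystem_code_def Let_def symp_radical_def[symmetric] D1_def)
  have D2: "add_subgroup D2" "D2 \<subseteq> symp_dual D2" "joint_eigenspace D2 Q\<^sub>2"
    "real (card D2) = ?q ^ CARD('n) / (real K2 * real R2)" "K2 \<ge> 1" "R2 \<ge> 1"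
    using code2(3) subgroup_symp_radical symp_radical_isotropic
    by (auto simp: subsystem_code_def Let_def symp_radical_def[symmetric] D2_def)
  obtain e1 where e1: "e1 \<in> symp_dual D1" "e1 \<noteq> 0" "swt e1 = d\<^sub>1"
    and min1: "\<And>v. v \<in> symp_dual D1 \<Longrightarrow> v \<noteq> 0 \<Longrightarrow> d\<^sub>1 \<le> swt v"
    using pure_code_minimum_word[OF code1(3,4)] unfolding D1_def by blast
  have "D1 \<subseteq> D2" by (rule subset_of_joint_eigenspaces[OF D2(1,2) D1(3) D2(3) assms(3)])
  then have min2: "d\<^sub>1 \<le> swt v" if "v \<in> symp_dual D2" "v \<noteq> 0" for v
    using min1 symp_dual_antimono that by blast
  have q: "?q > 0" by simp
  have "real R * real K = real K1 * real R1 * (real K2 * real R2)"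
    unfolding K R code1 code2 powr_add[symmetric] by (simp add: algebra_simps)
  then have "real (card D1 * card D2 * (R * K)) = real (CARD('a) ^ CARD('m))"
    using D1(4-6) D2(4-6) by (simp add: assms(4) mult_2 power_add)
  then have card: "card D1 * card D2 * (R * K) = CARD('a) ^ CARD('m)" by (simp only: of_nat_eq_iff)
  \<comment> \<open>The exponents are real, but \<open>R\<close> and \<open>K\<close> divide a power
    of \<open>p\<close> and hence are powers of \<open>p\<close> themselves; this supplies
    \<open>m\<close> and \<open>j\<close>.\<close>
  then have "R * K dvd ?p ^ (prime_degree TYPE('a) * CARD('m))"
    by (metis CARD_prime_degree dvd_triv_right power_mult)
  then obtain m where m: "R * K = ?p ^ m"
    using divides_primepow_nat[OF CHAR_prime[where 'a='a]] by blast
  then obtain j where j: "j \<le> m" "R = ?p ^ j"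
    by (metis divides_primepow_nat[OF CHAR_prime[where 'a='a]] dvd_triv_left)
  have Km: "K = ?p ^ (m - j)"
  proof -
    have "?p ^ j * K = ?p ^ j * ?p ^ (m - j)" using m j by (simp flip: power_add)
    then show ?thesis by simp
  qed
  obtain l r' :: "'n \<Rightarrow> 'm" where "halves l r'" by (rule exists_halves[OF assms(4)])
  then interpret halves l r' .
  obtain Q :: "(complex^('a^'m)) set" and C where "subsystem_code Q C K R d\<^sub>1" "pure_to C d\<^sub>1"
    using pure_code_of_direct_sum[OF D1(1,2) D2(1,2) e1(1,2) _ _ _ j(1)] min1 min2 card m
    unfolding e1(3) Km j(2)[symmetric] by auto
  then have "pure_subsystem_code Q C (?s - r) r d\<^sub>1"
    using K R by (auto simp: pure_subsystem_code_def subsystem_code_log_def)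
  then show "\<exists>(Q :: (complex^('a^'m)) set) C d. pure_subsystem_code Q C (?s - r) r d \<and> d \<ge> min d\<^sub>1 (2 * d\<^sub>2)"
    \<comment> \<open>The distance reached is exactly \<open>d\<^sub>1\<close>, which bounds the
      minimum from above.\<close>
    by (intro exI[of _ Q] exI[of _ C] exI[of _ d\<^sub>1]) simp
qed

end
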